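(* Let $A$ be a finite-dimensional algebra over a field $k$ with a directed stratification given by idempotents $e_1,\dots,e_n$, and let $\mathcal{A}$ be the associated category. Let $M$ be a finitely generated $A$-module and let $P=P_M$ be its projective cover. Then $P$ is supported on $\mathcal{A}_M$ (that is, $P(y)=0$ for every object $y$ of $\mathcal{A}$ not in $\mathcal{A}_M$), and for any $M$-minimal object $x$ in $\mathcal{A}$ the module $P(x)$ is a projective cover of $M(x)$ as an $e_xAe_x$-module.
   Context: A finite-dimensional $k$-algebra $A$ has a directed stratification of length $n$, given by $e_1,\dots,e_n$, if $e_1,\dots,e_n\in A$ are pairwise orthogonal idempotents (not necessarily primitive) with $\sum_{i=1}^n e_i=1_A$ and $e_iAe_j=0$ for all $i<j$. Modules are left modules. The associated category $\mathcal{A}$ is the finite category whose objects $x_1,\dots,x_n$ are in bijective correspondence with $e_1,\dots,e_n$ and whose morphisms $x_i\to x_j$ are in bijective correspondence with a $k$-basis of $e_jAe_i$; in this way $A$ is regarded as the category algebra $k\mathcal{A}$. For an object $x=x_i$ write $e_x=e_i$, and write $\mathcal{A}(y,x)$ for the set of morphisms $y\to x$ in $\mathcal{A}$; thus $\mathcal{A}(y,x)\neq\emptyset$ means $e_xAe_y\neq 0$. Finitely generated $A$-modules are identified with representations of $\mathcal{A}$, that is, functors from $\mathcal{A}$ to finite-dimensional $k$-vector spaces; $M(x)=e_xM$ denotes the evaluation of $M$ at $x$, which is an $e_xAe_x$-module. An object $x$ of $\mathcal{A}$ is $M$-minimal if $M(x)\neq 0$ and $M(y)=0$ for every object $y\neq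 x$ with $\mathcal{A}(y,x)\neq\emptyset$. $\mathcal{A}_M$ is the full subcategory of $\mathcal{A}$ consisting of all objects $y$ with $\mathcal{A}(x,y)\neq\emptyset$ for some $M$-minimal object $x$.
   Formalization: The associated finite category is assumed to exist (all e_i nonzero; e_jAe_i and e_lAe_j nonzero imply e_lAe_i nonzero); without this it is undefined and the support claim fails, e.g. for the path algebra of 1→2→3 with zero composite and M the sum of the simples. *)

theory Defs
  imports "Jordan_Normal_Form.Missing_VectorSpace" "HOL-Algebra.AbelCoset"
begin

section \<open>Left modules over a not necessarily commutative ring\<close>

text \<open>These are the axioms of the locale \<^locale>\<open>module\<close> of HOL-Algebra, which is restricted
  to commutative base rings.\<close>

locale left_module = R?: ring R + M?: abelian_group M
  for R :: "('a, 'r) ring_scheme" (structure) and M :: "('a, 'm, 's) module_scheme" (structure) +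
  assumes smult_closed:
      "\<lbrakk>a \<in> carrier R; x \<in> carrier M\<rbrakk> \<Longrightarrow> a \<odot>\<^bsub>M\<^esub> x \<in> carrier M"
    and smult_l_distr:
      "\<lbrakk>a \<in> carrier R; b \<in> carrier R; x \<in> carrier M\<rbrakk> \<Longrightarrow>
        (a \<oplus> b) \<odot>\<^bsub>M\<^esub> x = a \<odot>\<^bsub>M\<^esub> x \<oplus>\<^bsub>M\<^esub> b \<odot>\<^bsub>M\<^esub> x"
    and smult_r_distr:
      "\<lbrakk>a \<in> carrier R; x \<in> carrier M; y \<in> carrier M\<rbrakk> \<Longrightarrow>
        a \<odot>\<^bsub>M\<^esub> (x \<oplus>\<^bsub>M\<^esub> y) = a \<odot>\<^bsub>M\<^esub> x \<oplus>\<^bsub>M\<^esub> a \<odot>\<^bsub>M\<^esub> y"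
    and smult_assoc1:
      "\<lbrakk>a \<in> carrier R; b \<in> carrier R; x \<in> carrier M\<rbrakk> \<Longrightarrow>
        (a \<otimes> b) \<odot>\<^bsub>M\<^esub> x = a \<odot>\<^bsub>M\<^esub> (b \<odot>\<^bsub>M\<^esub> x)"
    and smult_one:
      "x \<in> carrier M \<Longrightarrow> \<one> \<odot>\<^bsub>M\<^esub> x = x"

text \<open>VectorSpace declares another locale of the name \<open>submodule\<close> that presupposes a commutative
  base ring; the one of HOL-Algebra does not.\<close>

abbreviation is_submodule ::
    "'m set \<Rightarrow> ('a, 'r) ring_scheme \<Rightarrow> ('a, 'm, 's) module_scheme \<Rightarrow> bool" where
  "is_submodule H R M \<equiv> Module.submodule H R M"

definition finitely_generated ::
    "('a, 'r) ring_scheme \<Rightarrow> ('a, 'm, 's) module_scheme \<Rightarrow> bool" where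
  "finitely_generated R M \<longleftrightarrow>
     (\<exists>S. finite S \<and> S \<subseteq> carrier M \<and>
          (\<forall>H. is_submodule H R M \<and> S \<subseteq> H \<longrightarrow> H = carrier M))"

definition left_module_hom ::
    "('a, 'r) ring_scheme \<Rightarrow> ('a, 'm, 's) module_scheme \<Rightarrow> ('a, 'n, 't) module_scheme \<Rightarrow> ('m \<Rightarrow> 'n) set"
  where
  "left_module_hom R M N =
     {f \<in> carrier M \<rightarrow> carrier N.
        (\<forall>x \<in> carrier M. \<forall>y \<in> carrier M. f (x \<oplus>\<^bsub>M\<^esub> y) = f x \<oplus>\<^bsub>N\<^esub> f y) \<and>
        (\<forall>a \<in> carrier R. \<forall>x \<in> carrier M. f (a \<odot>\<^bsub>M\<^esub> x) = a \<odot>\<^bsub>N\<^esub> f x)}"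

definition zero_module :: "('a, 'm, 's) module_scheme \<Rightarrow> bool" where
  "zero_module M \<longleftrightarrow> carrier M = {\<zero>\<^bsub>M\<^esub>}"


section \<open>Projective modules and projective covers\<close>

text \<open>Projectivity is the lifting property along surjections. A HOL definition cannot quantify over
  modules on all types, so the modules \<open>N\<close> and \<open>L\<close> live on two types that are determined by \<open>P\<close>:
  they are large enough for \<open>P\<close> itself and for the free module on the set \<open>P\<close>. Hence nothing is
  lost: \<open>projective_module_lift\<close> below derives the lifting property for \<open>N\<close> and \<open>L\<close> on arbitrary
  types.\<close>

definition projective_module ::
    "('a, 'r) ring_scheme \<Rightarrow> ('a, 'p) module \<Rightarrow> bool" where
  "projective_module R P \<longleftrightarrow> left_module R P \<and>
     (\<forall>(N :: ('a, 'p \<Rightarrow> 'a) module) (L :: ('a, 'p) module) g f.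
        left_module R N \<and> left_module R L \<and>
        g \<in> left_module_hom R N L \<and> g ` carrier N = carrier L \<and>
        f \<in> left_module_hom R P L \<longrightarrow>
        (\<exists>h \<in> left_module_hom R P N. \<forall>p \<in> carrier P. g (h p) = f p))"

definition free_module :: "('a, 'r) ring_scheme \<Rightarrow> 'p set \<Rightarrow> ('a, 'p \<Rightarrow> 'a) module" where
  "free_module R S =
     \<lparr>carrier = {\<phi>. (\<forall>p \<in> S. \<phi> p \<in> carrier R) \<and> (\<forall>p. p \<notin> S \<longrightarrow> \<phi> p = \<zero>\<^bsub>R\<^esub>) \<and>
                    finite {p. \<phi> p \<noteq> \<zero>\<^bsub>R\<^esub>}},
      mult = undefined, one = undefined,
      zero = (\<lambda>_. \<zero>\<^bsub>R\<^esub>), add = (\<lambda>\<phi> \<psi> p. \<phi> p \<oplus>\<^bsub>R\<^esub> \<psi> p),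
      smult = (\<lambda>a \<phi> p. a \<otimes>\<^bsub>R\<^esub> \<phi> p)\<rparr>"

definition linear_extension ::
    "('a, 'r) ring_scheme \<Rightarrow> ('a, 'm, 's) module_scheme \<Rightarrow> ('p \<Rightarrow> 'm) \<Rightarrow> ('p \<Rightarrow> 'a) \<Rightarrow> 'm" where
  "linear_extension R M \<nu> \<phi> = (\<Oplus>\<^bsub>M\<^esub>p \<in> {p. \<phi> p \<noteq> \<zero>\<^bsub>R\<^esub>}. \<phi> p \<odot>\<^bsub>M\<^esub> \<nu> p)"

lemma (in ring) free_module_left_module: "left_module R (free_module R S)"
proof -
  have fin_add: "finite {p. \<phi> p \<oplus> \<psi> p \<noteq> \<zero>}"
    if "finite {p. \<phi> p \<noteq> \<zero>}" "finite {p. \<psi> p \<noteq> \<zero>}" for \<phi> \<psi> :: "'p \<Rightarrow> 'a"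
    by (rule finite_subset[OF _ finite_UnI[OF that]]) auto
  have fin_smult: "finite {p. a \<otimes> \<phi> p \<noteq> \<zero>}"
    if "finite {p. \<phi> p \<noteq> \<zero>}" "a \<in> carrier R" for a and \<phi> :: "'p \<Rightarrow> 'a"
    by (rule finite_subset[OF _ that(1)]) (use that(2) in auto)
  have in_R: "\<phi> p \<in> carrier R" if "\<phi> \<in> carrier (free_module R S)" for \<phi> p
    using that by (cases "p \<in> S") (auto simp: free_module_def)
  have "abelian_group (free_module R S)"
  proof (rule abelian_groupI)
    show "\<exists>\<psi> \<in> carrier (free_module R S).
        \<psi> \<oplus>\<^bsub>free_module R S\<^esub> \<phi> = \<zero>\<^bsub>free_module R S\<^esub>"
      if "\<phi> \<in> carrier (free_module R S)" for \<phi>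
    proof (rule bexI[of _ "\<lambda>p. \<ominus> \<phi> p"])
      show "(\<lambda>p. \<ominus> \<phi> p) \<oplus>\<^bsub>free_module R S\<^esub> \<phi> = \<zero>\<^bsub>free_module R S\<^esub>"
        using in_R[OF that] by (auto simp: free_module_def l_neg)
      have "finite {p. \<ominus> \<phi> p \<noteq> \<zero>}"
        by (rule finite_subset[of _ "{p. \<phi> p \<noteq> \<zero>}"]) (use that in \<open>auto simp: free_module_def\<close>)
      then show "(\<lambda>p. \<ominus> \<phi> p) \<in> carrier (free_module R S)"
        using that by (auto simp: free_module_def)
    qed
  next
    fix \<phi> \<psi> \<chi>
    assume \<phi>: "\<phi> \<in> carrier (free_module R S)" and \<psi>: "\<psi> \<in> carrier (free_module R S)"
      and \<chi>: "\<chi> \<in> carrier (free_module R S)"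
    note [simp] = in_R[OF \<phi>] in_R[OF \<psi>] in_R[OF \<chi>]
    show "\<phi> \<oplus>\<^bsub>free_module R S\<^esub> \<psi> \<oplus>\<^bsub>free_module R S\<^esub> \<chi> =
        \<phi> \<oplus>\<^bsub>free_module R S\<^esub> (\<psi> \<oplus>\<^bsub>free_module R S\<^esub> \<chi>)"
      by (simp add: free_module_def a_assoc)
  next
    fix \<phi> \<psi>
    assume \<phi>: "\<phi> \<in> carrier (free_module R S)" and \<psi>: "\<psi> \<in> carrier (free_module R S)"
    note [simp] = in_R[OF \<phi>] in_R[OF \<psi>]
    show "\<phi> \<oplus>\<^bsub>free_module R S\<^esub> \<psi> \<in> carrier (free_module R S)"
      using \<phi> \<psi> by (simp add: free_module_def fin_add)
    show "\<phi> \<oplus>\<^bsub>free_module R S\<^esub> \<psi> = \<psi> \<oplus>\<^bsub>free_module R S\<^esub> \<phi>"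
      by (simp add: free_module_def a_comm)
  next
    fix \<phi> assume \<phi>: "\<phi> \<in> carrier (free_module R S)"
    note [simp] = in_R[OF \<phi>]
    show "\<zero>\<^bsub>free_module R S\<^esub> \<oplus>\<^bsub>free_module R S\<^esub> \<phi> = \<phi>"
      by (simp add: free_module_def)
  qed (simp add: free_module_def)
  then show ?thesis
  proof (intro left_module.intro left_module_axioms.intro ring_axioms)
    fix a \<phi> \<psi>
    assume a: "a \<in> carrier R"
      and \<phi>: "\<phi> \<in> carrier (free_module R S)" and \<psi>: "\<psi> \<in> carrier (free_module R S)"
    note [simp] = a in_R[OF \<phi>] in_R[OF \<psi>]
    show "a \<odot>\<^bsub>free_module R S\<^esub> (\<phi> \<oplus>\<^bsub>free_module R S\<^esub> \<psi>) =
        a \<odot>\<^bsub>free_module R S\<^esub> \<phi> \<oplus>\<^bsub>free_module R S\<^esub> a \<odot>\<^bsub>free_module R S\<^esub> \<psi>"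
      by (simp add: free_module_def r_distr)
  next
    fix a b \<phi>
    assume a: "a \<in> carrier R" and b: "b \<in> carrier R" and \<phi>: "\<phi> \<in> carrier (free_module R S)"
    note [simp] = a b in_R[OF \<phi>]
    show "a \<odot>\<^bsub>free_module R S\<^esub> \<phi> \<in> carrier (free_module R S)"
      using \<phi> by (simp add: free_module_def fin_smult)
    show "(a \<oplus> b) \<odot>\<^bsub>free_module R S\<^esub> \<phi> =
        a \<odot>\<^bsub>free_module R S\<^esub> \<phi> \<oplus>\<^bsub>free_module R S\<^esub> b \<odot>\<^bsub>free_module R S\<^esub> \<phi>"
      by (simp add: free_module_def l_distr)
    show "(a \<otimes> b) \<odot>\<^bsub>free_module R S\<^esub> \<phi> =
        a \<odot>\<^bsub>free_module R S\<^esub> (b \<odot>\<^bsub>free_module R S\<^esub> \<phi>)"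
      by (simp add: free_module_def m_assoc)
  next
    fix \<phi> assume \<phi>: "\<phi> \<in> carrier (free_module R S)"
    note [simp] = in_R[OF \<phi>]
    show "\<one> \<odot>\<^bsub>free_module R S\<^esub> \<phi> = \<phi>"
      by (simp add: free_module_def)
  qed
qed

lemma (in left_module) smult_zero_left: "x \<in> carrier M \<Longrightarrow> \<zero>\<^bsub>R\<^esub> \<odot>\<^bsub>M\<^esub> x = \<zero>\<^bsub>M\<^esub>"
  by (metis M.add.r_cancel_one' R.r_zero R.zero_closed smult_closed smult_l_distr)

lemma (in left_module) smult_zero_right: "a \<in> carrier R \<Longrightarrow> a \<odot>\<^bsub>M\<^esub> \<zero>\<^bsub>M\<^esub> = \<zero>\<^bsub>M\<^esub>"
  by (metis M.add.r_cancel_one' M.r_zero M.zero_closed smult_closed smult_r_distr)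

lemma (in left_module) smult_finsum:
  assumes "a \<in> carrier R" "finite T" "f \<in> T \<rightarrow> carrier M"
  shows "a \<odot>\<^bsub>M\<^esub> (\<Oplus>\<^bsub>M\<^esub>p \<in> T. f p) = (\<Oplus>\<^bsub>M\<^esub>p \<in> T. a \<odot>\<^bsub>M\<^esub> f p)"
  using assms(2,3)
proof (induction T)
  case empty
  then show ?case using assms(1) by (simp add: smult_zero_right)
next
  case (insert q T)
  then have "f \<in> T \<rightarrow> carrier M" "(\<lambda>p. a \<odot>\<^bsub>M\<^esub> f p) \<in> T \<rightarrow> carrier M" "f q \<in> carrier M"
    using assms(1) smult_closed by (auto simp: Pi_iff)
  then show ?case
    using insert assms(1) by (simp add: smult_r_distr smult_closed)
qed

lemma left_module_hom_zero:
  assumes "left_module R M" "left_module R N" "f \<in> left_module_hom R M N"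
  shows "f \<zero>\<^bsub>M\<^esub> = \<zero>\<^bsub>N\<^esub>"
proof -
  interpret M: left_module R M by fact
  interpret N: left_module R N by fact
  have "f \<zero>\<^bsub>M\<^esub> \<in> carrier N" "f (\<zero>\<^bsub>M\<^esub> \<oplus>\<^bsub>M\<^esub> \<zero>\<^bsub>M\<^esub>) = f \<zero>\<^bsub>M\<^esub> \<oplus>\<^bsub>N\<^esub> f \<zero>\<^bsub>M\<^esub>"
    using assms(3) M.M.zero_closed unfolding left_module_hom_def by blast+
  then show ?thesis
    by (metis M.M.r_zero M.M.zero_closed N.M.add.r_cancel_one')
qed

lemma left_module_hom_finsum:
  assumes "left_module R M" "left_module R N" "f \<in> left_module_hom R M N"
    and "finite T" "v \<in> T \<rightarrow> carrier M"
  shows "f (\<Oplus>\<^bsub>M\<^esub>p \<in> T. v p) = (\<Oplus>\<^bsub>N\<^esub>p \<in> T. f (v p))"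
  using assms(4,5)
proof (induction T)
  interpret M: left_module R M by fact
  interpret N: left_module R N by fact
  case empty
  show ?case using left_module_hom_zero[OF assms(1-3)] by simp
next
  interpret M: left_module R M by fact
  interpret N: left_module R N by fact
  case (insert q T)
  then have "v \<in> T \<rightarrow> carrier M" "v q \<in> carrier M" by (auto simp: Pi_iff)
  moreover from this have "(\<lambda>p. f (v p)) \<in> T \<rightarrow> carrier N" "f (v q) \<in> carrier N"
    using assms(3) by (auto simp: left_module_hom_def)
  ultimately show ?case
    using insert assms(3) by (simp add: left_module_hom_def)
qed

lemma (in left_module) linear_extension_superset:
  assumes "\<phi> \<in> carrier (free_module R S)" "\<nu> \<in> S \<rightarrow> carrier M"
    and "finite T" "{p. \<phi> p \<noteq> \<zero>\<^bsub>R\<^esub>} \<subseteq> T" "T \<subseteq> S"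
  shows "linear_extension R M \<nu> \<phi> = (\<Oplus>\<^bsub>M\<^esub>p \<in> T. \<phi> p \<odot>\<^bsub>M\<^esub> \<nu> p)"
  unfolding linear_extension_def
proof (rule M.add.finprod_mono_neutral_cong_left)
  show "(\<lambda>p. \<phi> p \<odot>\<^bsub>M\<^esub> \<nu> p) \<in> T \<rightarrow> carrier M"
    using assms by (auto simp: free_module_def intro!: smult_closed)
  show "\<phi> p \<odot>\<^bsub>M\<^esub> \<nu> p = \<zero>\<^bsub>M\<^esub>" if "p \<in> T - {p. \<phi> p \<noteq> \<zero>\<^bsub>R\<^esub>}" for p
    using that assms by (auto intro!: smult_zero_left)
qed (use assms in auto)

lemma (in left_module) linear_extension_hom:
  assumes \<nu>: "\<nu> \<in> S \<rightarrow> carrier M"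
  shows "linear_extension R M \<nu> \<in> left_module_hom R (free_module R S) M"
proof -
  let ?F = "free_module R S" and ?E = "linear_extension R M \<nu>"
  interpret F: left_module R ?F by (rule R.free_module_left_module)
  have supp: "finite {p. \<phi> p \<noteq> \<zero>\<^bsub>R\<^esub>}" "{p. \<phi> p \<noteq> \<zero>\<^bsub>R\<^esub>} \<subseteq> S" if "\<phi> \<in> carrier ?F" for \<phi>
    using that by (auto simp: free_module_def)
  have in_R: "\<phi> p \<in> carrier R" if "\<phi> \<in> carrier ?F" for \<phi> p
    using that by (cases "p \<in> S") (auto simp: free_module_def)
  have closed: "(\<lambda>p. \<phi> p \<odot>\<^bsub>M\<^esub> \<nu> p) \<in> T \<rightarrow> carrier M" if "\<phi> \<in> carrier ?F" "T \<subseteq> S" for \<phi> T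
    using that in_R \<nu> by (auto intro!: smult_closed)
  have "?E \<phi> \<in> carrier M" if "\<phi> \<in> carrier ?F" for \<phi>
    unfolding linear_extension_def by (intro M.finsum_closed closed that supp)
  moreover have "?E (\<phi> \<oplus>\<^bsub>?F\<^esub> \<psi>) = ?E \<phi> \<oplus>\<^bsub>M\<^esub> ?E \<psi>"
    if \<phi>: "\<phi> \<in> carrier ?F" and \<psi>: "\<psi> \<in> carrier ?F" for \<phi> \<psi>
  proof -
    let ?T = "{p. \<phi> p \<noteq> \<zero>\<^bsub>R\<^esub>} \<union> {p. \<psi> p \<noteq> \<zero>\<^bsub>R\<^esub>}"
    have T: "finite ?T" "?T \<subseteq> S" using supp[OF \<phi>] supp[OF \<psi>] by auto
    have sub: "{p. (\<phi> \<oplus>\<^bsub>?F\<^esub> \<psi>) p \<noteq> \<zero>\<^bsub>R\<^esub>} \<subseteq> ?T" by (auto simp: free_module_def)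
    have "?E (\<phi> \<oplus>\<^bsub>?F\<^esub> \<psi>) = (\<Oplus>\<^bsub>M\<^esub>p \<in> ?T. (\<phi> \<oplus>\<^bsub>?F\<^esub> \<psi>) p \<odot>\<^bsub>M\<^esub> \<nu> p)"
      by (rule linear_extension_superset[OF F.a_closed[OF \<phi> \<psi>] \<nu> T(1) sub T(2)])
    also have "\<dots> = (\<Oplus>\<^bsub>M\<^esub>p \<in> ?T. \<phi> p \<odot>\<^bsub>M\<^esub> \<nu> p \<oplus>\<^bsub>M\<^esub> \<psi> p \<odot>\<^bsub>M\<^esub> \<nu> p)"
    proof (rule M.finsum_cong'[OF refl])
      show "(\<lambda>p. \<phi> p \<odot>\<^bsub>M\<^esub> \<nu> p \<oplus>\<^bsub>M\<^esub> \<psi> p \<odot>\<^bsub>M\<^esub> \<nu> p) \<in> ?T \<rightarrow> carrier M"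
        using closed[OF \<phi> T(2)] closed[OF \<psi> T(2)] by (auto simp: Pi_iff)
      show "(\<phi> \<oplus>\<^bsub>?F\<^esub> \<psi>) p \<odot>\<^bsub>M\<^esub> \<nu> p = \<phi> p \<odot>\<^bsub>M\<^esub> \<nu> p \<oplus>\<^bsub>M\<^esub> \<psi> p \<odot>\<^bsub>M\<^esub> \<nu> p" if "p \<in> ?T" for p
      proof -
        have "\<nu> p \<in> carrier M" using that T(2) \<nu> by blast
        then show ?thesis
          using smult_l_distr[OF in_R[OF \<phi>] in_R[OF \<psi>]] by (simp add: free_module_def)
      qed
    qed
    also have "\<dots> = ?E \<phi> \<oplus>\<^bsub>M\<^esub> ?E \<psi>"
      using M.finsum_addf[OF closed[OF \<phi> T(2)] closed[OF \<psi> T(2)]]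
        linear_extension_superset[OF \<phi> \<nu> T(1) _ T(2)]
        linear_extension_superset[OF \<psi> \<nu> T(1) _ T(2)] by simp
    finally show ?thesis .
  qed
  moreover have "?E (a \<odot>\<^bsub>?F\<^esub> \<phi>) = a \<odot>\<^bsub>M\<^esub> ?E \<phi>"
    if a: "a \<in> carrier R" and \<phi>: "\<phi> \<in> carrier ?F" for a \<phi>
  proof -
    let ?T = "{p. \<phi> p \<noteq> \<zero>\<^bsub>R\<^esub>}"
    note T = supp[OF \<phi>]
    have sub: "{p. (a \<odot>\<^bsub>?F\<^esub> \<phi>) p \<noteq> \<zero>\<^bsub>R\<^esub>} \<subseteq> ?T" using a by (auto simp: free_module_def)
    have "?E (a \<odot>\<^bsub>?F\<^esub> \<phi>) = (\<Oplus>\<^bsub>M\<^esub>p \<in> ?T. (a \<odot>\<^bsub>?F\<^esub> \<phi>) p \<odot>\<^bsub>M\<^esub> \<nu> p)"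
      by (rule linear_extension_superset[OF F.smult_closed[OF a \<phi>] \<nu> T(1) sub T(2)])
    also have "\<dots> = (\<Oplus>\<^bsub>M\<^esub>p \<in> ?T. a \<odot>\<^bsub>M\<^esub> (\<phi> p \<odot>\<^bsub>M\<^esub> \<nu> p))"
    proof (rule M.finsum_cong'[OF refl])
      show "(\<lambda>p. a \<odot>\<^bsub>M\<^esub> (\<phi> p \<odot>\<^bsub>M\<^esub> \<nu> p)) \<in> ?T \<rightarrow> carrier M"
        using closed[OF \<phi> T(2)] a by (blast intro: smult_closed)
      show "(a \<odot>\<^bsub>?F\<^esub> \<phi>) p \<odot>\<^bsub>M\<^esub> \<nu> p = a \<odot>\<^bsub>M\<^esub> (\<phi> p \<odot>\<^bsub>M\<^esub> \<nu> p)" if "p \<in> ?T" for p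
      proof -
        have "\<nu> p \<in> carrier M" using that T(2) \<nu> by blast
        then show ?thesis
          using smult_assoc1[OF a in_R[OF \<phi>]] by (simp add: free_module_def)
      qed
    qed
    also have "\<dots> = a \<odot>\<^bsub>M\<^esub> ?E \<phi>"
      unfolding linear_extension_def using smult_finsum[OF a T(1) closed[OF \<phi> T(2)]] by simp
    finally show ?thesis .
  qed
  ultimately show ?thesis by (simp add: left_module_hom_def)
qed

lemma linear_extension_comp:
  assumes "left_module R N" "left_module R L" "g \<in> left_module_hom R N L"
    and "\<nu> \<in> S \<rightarrow> carrier N" "\<phi> \<in> carrier (free_module R S)"
  shows "g (linear_extension R N \<nu> \<phi>) = linear_extension R L (\<lambda>p. g (\<nu> p)) \<phi>"
proof -
  interpret N: left_module R N by fact
  interpret L: left_module R L by fact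
  let ?T = "{p. \<phi> p \<noteq> \<zero>\<^bsub>R\<^esub>}"
  have T: "finite ?T" "?T \<subseteq> S" using assms(5) by (auto simp: free_module_def)
  have \<phi>R: "\<phi> p \<in> carrier R" if "p \<in> ?T" for p
    using that T(2) assms(5) by (auto simp: free_module_def)
  have \<nu>N: "\<nu> p \<in> carrier N" if "p \<in> ?T" for p using that T(2) assms(4) by blast
  have gL: "g x \<in> carrier L" if "x \<in> carrier N" for x
    using that assms(3) by (auto simp: left_module_hom_def)
  have "g (linear_extension R N \<nu> \<phi>) = (\<Oplus>\<^bsub>L\<^esub>p \<in> ?T. g (\<phi> p \<odot>\<^bsub>N\<^esub> \<nu> p))"
    unfolding linear_extension_def
    by (rule left_module_hom_finsum[OF assms(1-3) T(1)]) (use \<phi>R \<nu>N N.smult_closed in blast)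
  also have "\<dots> = linear_extension R L (\<lambda>p. g (\<nu> p)) \<phi>"
    unfolding linear_extension_def
  proof (rule L.M.finsum_cong'[OF refl])
    show "(\<lambda>p. \<phi> p \<odot>\<^bsub>L\<^esub> g (\<nu> p)) \<in> ?T \<rightarrow> carrier L"
      using \<phi>R \<nu>N gL L.smult_closed by blast
    show "g (\<phi> p \<odot>\<^bsub>N\<^esub> \<nu> p) = \<phi> p \<odot>\<^bsub>L\<^esub> g (\<nu> p)" if "p \<in> ?T" for p
      using \<phi>R[OF that] \<nu>N[OF that] assms(3) by (simp add: left_module_hom_def)
  qed
  finally show ?thesis .
qed

lemma projective_module_lift:
  fixes P :: "('a, 'p) module" and N :: "('a, 'n, 's) module_scheme"
    and L :: "('a, 'l, 't) module_scheme"
  assumes P: "projective_module R P" and N: "left_module R N" and L: "left_module R L"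
    and g: "g \<in> left_module_hom R N L" "g ` carrier N = carrier L"
    and f: "f \<in> left_module_hom R P L"
  shows "\<exists>h \<in> left_module_hom R P N. \<forall>p \<in> carrier P. g (h p) = f p"
proof -
  have modP: "left_module R P" using P by (simp add: projective_module_def)
  interpret P: left_module R P by fact
  interpret N: left_module R N by fact
  interpret L: left_module R L by fact
  let ?F = "free_module R (carrier P)" and ?\<epsilon> = "linear_extension R P (\<lambda>p. p)"
  have modF: "left_module R ?F" by (rule P.R.free_module_left_module)
  have \<epsilon>: "?\<epsilon> \<in> left_module_hom R ?F P" by (rule P.linear_extension_hom) auto
  have surj: "?\<epsilon> ` carrier ?F = carrier P"
  proof
    show "?\<epsilon> ` carrier ?F \<subseteq> carrier P" using \<epsilon> by (auto simp: left_module_hom_def)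
    show "carrier P \<subseteq> ?\<epsilon> ` carrier ?F"
    proof
      fix p assume p: "p \<in> carrier P"
      let ?d = "\<lambda>q. if q = p then \<one>\<^bsub>R\<^esub> else \<zero>\<^bsub>R\<^esub>"
      have fin: "finite {q. ?d q \<noteq> \<zero>\<^bsub>R\<^esub>}"
        by (rule finite_subset[of _ "{p}"]) auto
      then have d: "?d \<in> carrier ?F" using p by (auto simp: free_module_def)
      have "?\<epsilon> ?d = (\<Oplus>\<^bsub>P\<^esub>q \<in> {p}. ?d q \<odot>\<^bsub>P\<^esub> q)"
        by (rule P.linear_extension_superset[OF d]) (use p in auto)
      also have "\<dots> = p" using p by (simp add: P.smult_one)
      finally show "p \<in> ?\<epsilon> ` carrier ?F" using d by force
    qed
  qed
  have id: "(\<lambda>p. p) \<in> left_module_hom R P P" by (simp add: left_module_hom_def)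
  have "\<exists>h \<in> left_module_hom R P ?F. \<forall>p \<in> carrier P. ?\<epsilon> (h p) = p"
    by (rule P[unfolded projective_module_def, THEN conjunct2, rule_format, of ?F P])
       (intro conjI modF modP \<epsilon> surj id)
  then obtain s where s: "s \<in> left_module_hom R P ?F" "\<And>p. p \<in> carrier P \<Longrightarrow> ?\<epsilon> (s p) = p"
    by blast
  have fL: "f p \<in> carrier L" if "p \<in> carrier P" for p
    using that f by (auto simp: left_module_hom_def)
  then have "\<forall>p \<in> carrier P. \<exists>y. y \<in> carrier N \<and> g y = f p"
    using g(2) by (metis imageE)
  then obtain \<nu> where \<nu>: "\<And>p. p \<in> carrier P \<Longrightarrow> \<nu> p \<in> carrier N \<and> g (\<nu> p) = f p"
    by metis
  then have \<nu>N: "\<nu> \<in> carrier P \<rightarrow> carrier N" by blast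
  let ?E = "linear_extension R N \<nu>"
  have E: "?E \<in> left_module_hom R ?F N" by (rule N.linear_extension_hom[OF \<nu>N])
  have sF: "s p \<in> carrier ?F" if "p \<in> carrier P" for p
    using that s(1) by (auto simp: left_module_hom_def)
  have "(\<lambda>p. ?E (s p)) \<in> left_module_hom R P N"
    using E s(1) sF by (simp add: left_module_hom_def Pi_iff)
  moreover have "g (?E (s p)) = f p" if p: "p \<in> carrier P" for p
  proof -
    let ?T = "{q. s p q \<noteq> \<zero>\<^bsub>R\<^esub>}"
    have T: "?T \<subseteq> carrier P" using sF[OF p] by (auto simp: free_module_def)
    have sR: "s p q \<in> carrier R" if "q \<in> carrier P" for q
      using that sF[OF p] by (auto simp: free_module_def)
    have "g (?E (s p)) = linear_extension R L (\<lambda>q. g (\<nu> q)) (s p)"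
      by (rule linear_extension_comp[OF N L g(1) \<nu>N sF[OF p]])
    also have "\<dots> = linear_extension R L (\<lambda>q. f q) (s p)"
      unfolding linear_extension_def
      by (rule L.M.finsum_cong'[OF refl])
         (use T \<nu> fL sR L.smult_closed in \<open>blast, simp add: subset_iff\<close>)
    also have "\<dots> = f (?\<epsilon> (s p))"
      by (rule linear_extension_comp[OF modP L f _ sF[OF p], symmetric]) auto
    also have "\<dots> = f p" using s(2)[OF p] by simp
    finally show ?thesis .
  qed
  ultimately show ?thesis by (intro bexI[of _ "\<lambda>p. ?E (s p)"] ballI)
qed

definition superfluous ::
    "('a, 'r) ring_scheme \<Rightarrow> ('a, 'm, 's) module_scheme \<Rightarrow> 'm set \<Rightarrow> bool" where
  "superfluous R M H \<longleftrightarrow> is_submodule H R M \<and>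
     (\<forall>N. is_submodule N R M \<and> N <+>\<^bsub>M\<^esub> H = carrier M \<longrightarrow> N = carrier M)"

definition projective_cover ::
    "('a, 'r) ring_scheme \<Rightarrow> ('a, 'p) module \<Rightarrow> ('p \<Rightarrow> 'm) \<Rightarrow> ('a, 'm) module \<Rightarrow> bool" where
  "projective_cover R P \<pi> M \<longleftrightarrow>
     projective_module R P \<and> left_module R M \<and>
     \<pi> \<in> left_module_hom R P M \<and> \<pi> ` carrier P = carrier M \<and>
     superfluous R P (a_kernel P M \<pi>)"


section \<open>Algebras with a directed stratification\<close>

text \<open>The record type \<open>('k, 'a) module\<close> contains the ring multiplication and the unit of \<open>'a ring\<close>,
  so that one record carries both structures of an algebra, as in the locale \<^locale>\<open>algebra\<close> of
  HOL-Algebra, which is restricted to commutative algebras.\<close>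

locale k_algebra = vectorspace K A + A: ring A
  for K :: "('k, 'r) ring_scheme" and A :: "('k, 'a, 's) module_scheme" +
  assumes smult_mult_left:
      "\<lbrakk>c \<in> carrier K; a \<in> carrier A; b \<in> carrier A\<rbrakk> \<Longrightarrow>
        (c \<odot>\<^bsub>A\<^esub> a) \<otimes>\<^bsub>A\<^esub> b = c \<odot>\<^bsub>A\<^esub> (a \<otimes>\<^bsub>A\<^esub> b)"
    and smult_mult_right:
      "\<lbrakk>c \<in> carrier K; a \<in> carrier A; b \<in> carrier A\<rbrakk> \<Longrightarrow>
        a \<otimes>\<^bsub>A\<^esub> (c \<odot>\<^bsub>A\<^esub> b) = c \<odot>\<^bsub>A\<^esub> (a \<otimes>\<^bsub>A\<^esub> b)"

definition fin_dim_algebra ::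
    "('k, 'r) ring_scheme \<Rightarrow> ('k, 'a, 's) module_scheme \<Rightarrow> bool" where
  "fin_dim_algebra K A \<longleftrightarrow> k_algebra K A \<and> vectorspace.fin_dim K A"

text \<open>The Peirce component $uAv$, and the ring $uAu$ with unit $u$.\<close>

definition peirce :: "('a, 'r) ring_scheme \<Rightarrow> 'a \<Rightarrow> 'a \<Rightarrow> 'a set" where
  "peirce A u v = (\<lambda>a. u \<otimes>\<^bsub>A\<^esub> a \<otimes>\<^bsub>A\<^esub> v) ` carrier A"

definition corner :: "('k, 'a, 's) module_scheme \<Rightarrow> 'a \<Rightarrow> ('k, 'a, 's) module_scheme" where
  "corner A u = A\<lparr>carrier := peirce A u u, one := u\<rparr>"

definition directed_stratification ::
    "('a, 'r) ring_scheme \<Rightarrow> nat \<Rightarrow> (nat \<Rightarrow> 'a) \<Rightarrow> bool" where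
  "directed_stratification A n e \<longleftrightarrow>
     e \<in> {1..n} \<rightarrow> carrier A \<and>
     (\<forall>i \<in> {1..n}. e i \<otimes>\<^bsub>A\<^esub> e i = e i) \<and>
     (\<forall>i \<in> {1..n}. \<forall>j \<in> {1..n}. i \<noteq> j \<longrightarrow> e i \<otimes>\<^bsub>A\<^esub> e j = \<zero>\<^bsub>A\<^esub>) \<and>
     (\<Oplus>\<^bsub>A\<^esub>i \<in> {1..n}. e i) = \<one>\<^bsub>A\<^esub> \<and>
     (\<forall>i \<in> {1..n}. \<forall>j \<in> {1..n}. i < j \<longrightarrow> peirce A (e i) (e j) = {\<zero>\<^bsub>A\<^esub>})"


section \<open>The associated category\<close>

record ('o, 'f) category =
  Ob :: "'o set"
  Mor :: "'o \<Rightarrow> 'o \<Rightarrow> 'f set"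
  Ident :: "'o \<Rightarrow> 'f"
  Comp :: "'f \<Rightarrow> 'f \<Rightarrow> 'f"

locale finite_category =
  fixes \<C> :: "('o, 'f) category"
  assumes finite_Ob: "finite (Ob \<C>)"
    and finite_Mor: "\<lbrakk>x \<in> Ob \<C>; y \<in> Ob \<C>\<rbrakk> \<Longrightarrow> finite (Mor \<C> x y)"
    and Mor_disjoint:
      "\<lbrakk>x \<in> Ob \<C>; y \<in> Ob \<C>; x' \<in> Ob \<C>; y' \<in> Ob \<C>; (x, y) \<noteq> (x', y')\<rbrakk> \<Longrightarrow>
        Mor \<C> x y \<inter> Mor \<C> x' y' = {}"
    and Ident_in_Mor: "x \<in> Ob \<C> \<Longrightarrow> Ident \<C> x \<in> Mor \<C> x x"
    and Comp_in_Mor: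
      "\<lbrakk>x \<in> Ob \<C>; y \<in> Ob \<C>; z \<in> Ob \<C>; f \<in> Mor \<C> x y; g \<in> Mor \<C> y z\<rbrakk> \<Longrightarrow>
        Comp \<C> g f \<in> Mor \<C> x z"
    and Comp_Ident_left:
      "\<lbrakk>x \<in> Ob \<C>; y \<in> Ob \<C>; f \<in> Mor \<C> x y\<rbrakk> \<Longrightarrow> Comp \<C> (Ident \<C> y) f = f"
    and Comp_Ident_right:
      "\<lbrakk>x \<in> Ob \<C>; y \<in> Ob \<C>; f \<in> Mor \<C> x y\<rbrakk> \<Longrightarrow> Comp \<C> f (Ident \<C> x) = f"
    and Comp_assoc:
      "\<lbrakk>w \<in> Ob \<C>; x \<in> Ob \<C>; y \<in> Ob \<C>; z \<in> Ob \<C>;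
        f \<in> Mor \<C> w x; g \<in> Mor \<C> x y; h \<in> Mor \<C> y z\<rbrakk> \<Longrightarrow>
        Comp \<C> h (Comp \<C> g f) = Comp \<C> (Comp \<C> h g) f"

text \<open>The object $x_i$ is the index $i$, and the morphisms $x_i \to x_j$ correspond to a basis of
  $e_j A e_i$. The composition of \<open>\<C>\<close> is not required to be given by the multiplication of \<open>A\<close>:
  that would restrict to algebras with a multiplicative basis, such as the category algebra of
  \<open>\<C>\<close>, which is the special case in which the bijections are multiplicative.

  That \<open>\<C>\<close> is a category is a genuine condition on \<open>A\<close>: morphisms $x_i \to x_j$ and
  $x_j \to x_l$ have a composite, so $e_j A e_i \neq 0$ and $e_l A e_j \neq 0$ imply
  $e_l A e_i \neq 0$, and the identities force $e_i \neq 0$. It cannot be dropped: for the path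
  algebra of $1 \to 2 \to 3$ with zero composite and $M = S_1 \oplus S_2 \oplus S_3$ the only
  minimal object is $x_1$, there is no morphism $x_1 \to x_3$, and $P_M(x_3) \neq 0$.\<close>

definition associated_category ::
    "('k, 'r) ring_scheme \<Rightarrow> ('k, 'a, 's) module_scheme \<Rightarrow> nat \<Rightarrow> (nat \<Rightarrow> 'a) \<Rightarrow>
     (nat, 'f) category \<Rightarrow> bool" where
  "associated_category K A n e \<C> \<longleftrightarrow>
     finite_category \<C> \<and> Ob \<C> = {1..n} \<and>
     (\<forall>i \<in> {1..n}. \<forall>j \<in> {1..n}. \<exists>B \<beta>.
        vectorspace.basis K (A\<lparr>carrier := peirce A (e j) (e i)\<rparr>) B \<and>
        bij_betw \<beta> (Mor \<C> i j) B)"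

text \<open>The evaluation $M(x) = e_x M$, used with \<open>u\<close> the idempotent $e_x$; it is a module over
  \<open>corner A u\<close>.\<close>

definition evaluation :: "('a, 'm) module \<Rightarrow> 'a \<Rightarrow> ('a, 'm) module" where
  "evaluation M u = M\<lparr>carrier := (\<lambda>m. u \<odot>\<^bsub>M\<^esub> m) ` carrier M\<rparr>"

definition minimal_object ::
    "('o, 'f) category \<Rightarrow> ('o \<Rightarrow> 'a) \<Rightarrow> ('a, 'm) module \<Rightarrow> 'o \<Rightarrow> bool" where
  "minimal_object \<C> e M x \<longleftrightarrow> x \<in> Ob \<C> \<and> \<not> zero_module (evaluation M (e x)) \<and>
     (\<forall>y \<in> Ob \<C>. y \<noteq> x \<and> Mor \<C> y x \<noteq> {} \<longrightarrow> zero_module (evaluation M (e y)))"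

text \<open>The full subcategory $\mathcal{A}_M$; the values of \<open>Mor\<close> and \<open>Ident\<close> outside the objects are
  irrelevant.\<close>

definition subcategory_of_module ::
    "('o, 'f) category \<Rightarrow> ('o \<Rightarrow> 'a) \<Rightarrow> ('a, 'm) module \<Rightarrow> ('o, 'f) category" where
  "subcategory_of_module \<C> e M =
     \<C>\<lparr>Ob := {y \<in> Ob \<C>. \<exists>x. minimal_object \<C> e M x \<and> Mor \<C> x y \<noteq> {}}\<rparr>"

definition supported_on ::
    "('o, 'f) category \<Rightarrow> ('o \<Rightarrow> 'a) \<Rightarrow> ('a, 'm) module \<Rightarrow> ('o, 'f) category \<Rightarrow> bool" where
  "supported_on \<C> e M \<D> \<longleftrightarrow>
     (\<forall>y \<in> Ob \<C>. y \<notin> Ob \<D> \<longrightarrow> zero_module (evaluation M (e y)))"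

end

theory Submission
  imports Defs
begin

text \<open>Write \<open>y \<rightarrow> z\<close> if there is a morphism $y \to z$, that is, if $e_z A e_y \neq 0$
  (\<open>associated_category_Mor_empty_iff\<close>). This relation is reflexive and transitive because
  \<open>\<C>\<close> is a category, and antisymmetric because the stratification is directed. Let $Q$ be the
  set of objects of $\mathcal{A}_M$ and $\pi : P \to M$ the projective cover.

  If $M(y) \neq 0$, the least $x$ with $x \to y$ and $M(x) \neq 0$ is $M$-minimal, so $M$
  vanishes outside $Q$. As $Q$ is closed under successors, $N = \{p \in P \mid e_z p = 0
  \mbox{ for all } z \notin Q\}$ is a submodule of $P$. It maps onto $M$, because
  $\sum_{y \in Q} e_y p \in N$ has the same image as $p$. Since the kernel of $\pi$ is superfluous,
  $N = P$, which is the assertion about the support (\<open>projective_cover_supported\<close>).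

  Now let $x$ be $M$-minimal. An object $y \neq x$ with $y \to x$ is not in $Q$: from $w \to y$
  with $w$ minimal it would follow that $w \to x$, hence $w = x$ by minimality of $x$, and
  $x = y$ by antisymmetry. So $P(y) = 0$, and therefore $e_x a p = (e_x a e_x)(e_x p)$ for all
  $a \in A$ and $p \in P$ (\<open>corner_projection_smult\<close>). Moreover
  $\varphi(a) = e_x a e_x$ is a ring homomorphism $A \to e_x A e_x$, because no $y \neq x$
  satisfies both $x \to y$ and $y \to x$ (\<open>corner_projection_mult\<close>).

  These two facts make $P(x)$ a projective cover of $M(x)$. For projectivity, let $g : U \to V$ be a
  surjection of $e_x A e_x$-modules and $f : P(x) \to V$ a homomorphism. With $U$ and $V$ regarded
  as $A$-modules along $\varphi$, the map $p \mapsto f(e_x p)$ is $A$-linear, so it lifts to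
  $P \to U$, and the restriction of the lift to $P(x)$ lifts $f$
  (\<open>projective_module_evaluation\<close>). The kernel of $P(x) \to M(x)$ is superfluous because for
  every submodule $H$ whose sum with it is $P(x)$, the set $\{p \in P \mid e_x p \in H\}$ is a
  submodule whose sum with the kernel of $\pi$ is $P$, hence all of $P$ (\<open>superfluous_evaluation\<close>).\<close>

section \<open>Left modules\<close>

lemma (in left_module) is_submoduleI:
  assumes "H \<subseteq> carrier M" "\<zero>\<^bsub>M\<^esub> \<in> H"
    and "\<And>x y. x \<in> H \<Longrightarrow> y \<in> H \<Longrightarrow> x \<oplus>\<^bsub>M\<^esub> y \<in> H"
    and "\<And>a x. a \<in> carrier R \<Longrightarrow> x \<in> H \<Longrightarrow> a \<odot>\<^bsub>M\<^esub> x \<in> H"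
  shows "is_submodule H R M"
proof -
  have inv: "\<ominus>\<^bsub>M\<^esub> x \<in> H" if x: "x \<in> H" for x
  proof -
    have xM: "x \<in> carrier M" using x assms(1) by blast
    have "(\<ominus> \<one>) \<odot>\<^bsub>M\<^esub> x \<oplus>\<^bsub>M\<^esub> x = (\<ominus> \<one> \<oplus> \<one>) \<odot>\<^bsub>M\<^esub> x"
      using xM by (simp add: smult_l_distr smult_one)
    then have "(\<ominus> \<one>) \<odot>\<^bsub>M\<^esub> x \<oplus>\<^bsub>M\<^esub> x = \<zero>\<^bsub>M\<^esub>"
      using xM by (simp add: R.l_neg smult_zero_left)
    then have "\<ominus>\<^bsub>M\<^esub> x = (\<ominus> \<one>) \<odot>\<^bsub>M\<^esub> x"
      using xM by (intro M.minus_equality smult_closed) auto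
    then show ?thesis using assms(4)[of "\<ominus> \<one>" x] x by simp
  qed
  show ?thesis
    by (intro Module.submodule.intro subgroup.intro Module.submodule_axioms.intro)
       (use assms inv in \<open>auto simp: a_inv_def[symmetric]\<close>)
qed

lemma is_submoduleD:
  assumes "is_submodule H R M"
  shows "H \<subseteq> carrier M" "\<zero>\<^bsub>M\<^esub> \<in> H"
    and "\<And>x y. x \<in> H \<Longrightarrow> y \<in> H \<Longrightarrow> x \<oplus>\<^bsub>M\<^esub> y \<in> H"
    and "\<And>a x. a \<in> carrier R \<Longrightarrow> x \<in> H \<Longrightarrow> a \<odot>\<^bsub>M\<^esub> x \<in> H"
proof -
  interpret H: Module.submodule H R M by fact
  show "H \<subseteq> carrier M" "\<zero>\<^bsub>M\<^esub> \<in> H"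
    "\<And>x y. x \<in> H \<Longrightarrow> y \<in> H \<Longrightarrow> x \<oplus>\<^bsub>M\<^esub> y \<in> H"
    "\<And>a x. a \<in> carrier R \<Longrightarrow> x \<in> H \<Longrightarrow> a \<odot>\<^bsub>M\<^esub> x \<in> H"
    using H.subset H.one_closed H.m_closed H.smult_closed by auto
qed

lemma (in left_module) finsum_smult:
  assumes "finite T" "f \<in> T \<rightarrow> carrier R" "x \<in> carrier M"
  shows "(\<Oplus>i \<in> T. f i) \<odot>\<^bsub>M\<^esub> x = (\<Oplus>\<^bsub>M\<^esub>i \<in> T. f i \<odot>\<^bsub>M\<^esub> x)"
  using assms(1,2)
proof (induction T)
  case empty
  then show ?case using assms(3) by (simp add: smult_zero_left)
next
  case (insert q T)
  then have "f \<in> T \<rightarrow> carrier R" "f q \<in> carrier R" "(\<lambda>i. f i \<odot>\<^bsub>M\<^esub> x) \<in> T \<rightarrow> carrier M"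
    using assms(3) by (auto intro!: smult_closed)
  then show ?case using insert assms(3) by (simp add: smult_l_distr smult_closed)
qed

text \<open>The ring as a left module over itself. The fields \<open>mult\<close> and \<open>one\<close> of a module record
  play no role.\<close>

definition regular_module :: "('a, 'r) ring_scheme \<Rightarrow> ('a, 'a) module" where
  "regular_module R =
     \<lparr>carrier = carrier R, mult = undefined, one = undefined,
      zero = \<zero>\<^bsub>R\<^esub>, add = add R, smult = mult R\<rparr>"

lemma (in ring) regular_module_left_module: "left_module R (regular_module R)"
proof -
  have "abelian_group (regular_module R)"
    by (rule abelian_groupI)
       (auto simp: regular_module_def a_ac intro!: bexI[of _ "\<ominus> _"] l_neg)
  then show ?thesis
    by (intro left_module.intro left_module_axioms.intro ring_axioms)
       (auto simp: regular_module_def l_distr r_distr m_assoc)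
qed

text \<open>The module obtained from \<open>N\<close> by restriction of scalars along \<open>\<phi>\<close>.\<close>

definition restrict_scalars ::
    "('a \<Rightarrow> 'b) \<Rightarrow> ('b, 'm, 's) module_scheme \<Rightarrow> ('a, 'm) module" where
  "restrict_scalars \<phi> N =
     \<lparr>carrier = carrier N, mult = undefined, one = undefined,
      zero = \<zero>\<^bsub>N\<^esub>, add = add N, smult = (\<lambda>a x. \<phi> a \<odot>\<^bsub>N\<^esub> x)\<rparr>"

lemma restrict_scalars_left_module:
  assumes "ring R" "left_module S N" "\<phi> \<in> ring_hom R S"
  shows "left_module R (restrict_scalars \<phi> N)"
proof -
  interpret N: left_module S N by fact
  have "abelian_group (restrict_scalars \<phi> N)"
    by (rule abelian_groupI)
       (auto simp: restrict_scalars_def N.M.a_ac intro!: bexI[of _ "\<ominus>\<^bsub>N\<^esub> _"] N.M.l_neg)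
  moreover have "left_module_axioms R (restrict_scalars \<phi> N)"
    by (rule left_module_axioms.intro)
       (simp_all add: restrict_scalars_def ring_hom_memE[OF assms(3)] N.smult_closed
          N.smult_l_distr N.smult_r_distr N.smult_assoc1 N.smult_one)
  ultimately show ?thesis using assms(1) by (simp add: left_module_def)
qed


section \<open>Corner rings and evaluations\<close>

lemma (in ring) peirce_iff:
  assumes "u \<in> carrier R" "v \<in> carrier R" "u \<otimes> u = u" "v \<otimes> v = v"
  shows "x \<in> peirce R u v \<longleftrightarrow> x \<in> carrier R \<and> u \<otimes> x = x \<and> x \<otimes> v = x"
proof
  assume "x \<in> peirce R u v"
  then obtain a where a: "a \<in> carrier R" "x = u \<otimes> a \<otimes> v" by (auto simp: peirce_def)
  have "u \<otimes> (u \<otimes> a \<otimes> v) = (u \<otimes> u) \<otimes> a \<otimes> v" "u \<otimes> a \<otimes> v \<otimes> v = u \<otimes> a \<otimes> (v \<otimes> v)"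
    using a assms(1,2) by (simp_all only: m_assoc m_closed)
  then show "x \<in> carrier R \<and> u \<otimes> x = x \<and> x \<otimes> v = x" using a assms by simp
next
  assume "x \<in> carrier R \<and> u \<otimes> x = x \<and> x \<otimes> v = x"
  then show "x \<in> peirce R u v" unfolding peirce_def by (intro image_eqI[of _ _ x]) auto
qed

lemma (in ring) peirce_eq_zero_iff:
  assumes "u \<in> carrier R" "v \<in> carrier R"
  shows "peirce R u v = {\<zero>} \<longleftrightarrow> (\<forall>a \<in> carrier R. u \<otimes> a \<otimes> v = \<zero>)"
  unfolding peirce_def by (auto simp: image_iff) (blast intro: zero_closed)

lemma corner_simps [simp]:
  "carrier (corner A u) = peirce A u u" "\<one>\<^bsub>corner A u\<^esub> = u" "\<zero>\<^bsub>corner A u\<^esub> = \<zero>\<^bsub>A\<^esub>"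
  "add (corner A u) = add A" "mult (corner A u) = mult A"
  by (simp_all add: corner_def)

lemma evaluation_simps [simp]:
  "\<zero>\<^bsub>evaluation M u\<^esub> = \<zero>\<^bsub>M\<^esub>" "add (evaluation M u) = add M" "smult (evaluation M u) = smult M"
  by (simp_all add: evaluation_def)

lemma ring_corner:
  assumes "ring A" "u \<in> carrier A" "u \<otimes>\<^bsub>A\<^esub> u = u"
  shows "ring (corner A u)"
proof -
  interpret A: ring A by fact
  note mem = A.peirce_iff[OF assms(2,2,3,3)]
  show ?thesis
  proof (rule ringI)
    show "abelian_group (corner A u)"
    proof (rule abelian_groupI)
      show "\<exists>y \<in> carrier (corner A u). y \<oplus>\<^bsub>corner A u\<^esub> x = \<zero>\<^bsub>corner A u\<^esub>"
        if "x \<in> carrier (corner A u)" for x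
        using that assms(2)
        by (intro bexI[of _ "\<ominus>\<^bsub>A\<^esub> x"]) (auto simp: mem A.l_neg A.l_minus A.r_minus)
    qed (use assms(2) in \<open>auto simp: mem A.a_ac A.r_distr A.l_distr\<close>)
    show "monoid (corner A u)"
    proof (rule monoidI)
      show "x \<otimes>\<^bsub>corner A u\<^esub> y \<in> carrier (corner A u)"
        if "x \<in> carrier (corner A u)" "y \<in> carrier (corner A u)" for x y
        using that assms(2) A.m_assoc[of u x y] A.m_assoc[of x y u] by (auto simp: mem)
    qed (use assms(2,3) in \<open>auto simp: mem A.m_assoc\<close>)
  qed (auto simp: mem A.l_distr A.r_distr)
qed

lemma evaluation_mem_iff:
  assumes "left_module A M" and "u \<in> carrier A" "u \<otimes>\<^bsub>A\<^esub> u = u"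
  shows "x \<in> carrier (evaluation M u) \<longleftrightarrow> x \<in> carrier M \<and> u \<odot>\<^bsub>M\<^esub> x = x"
proof -
  interpret left_module A M by fact
  show ?thesis
  proof
    assume "x \<in> carrier (evaluation M u)"
    then obtain m where "m \<in> carrier M" "x = u \<odot>\<^bsub>M\<^esub> m" by (auto simp: evaluation_def)
    then show "x \<in> carrier M \<and> u \<odot>\<^bsub>M\<^esub> x = x"
      using assms(2,3) by (simp add: smult_closed smult_assoc1[symmetric])
  next
    assume "x \<in> carrier M \<and> u \<odot>\<^bsub>M\<^esub> x = x"
    then show "x \<in> carrier (evaluation M u)"
      unfolding evaluation_def by (auto intro!: image_eqI[of _ _ x])
  qed
qed

lemma zero_module_evaluation_iff:
  assumes "left_module A M" and "u \<in> carrier A"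
  shows "zero_module (evaluation M u) \<longleftrightarrow> (\<forall>m \<in> carrier M. u \<odot>\<^bsub>M\<^esub> m = \<zero>\<^bsub>M\<^esub>)"
proof -
  interpret left_module A M by fact
  show ?thesis
    unfolding zero_module_def evaluation_def
    by (auto simp: image_iff) (blast intro: M.zero_closed)
qed

lemma evaluation_left_module:
  assumes "left_module A M" "u \<in> carrier A" "u \<otimes>\<^bsub>A\<^esub> u = u"
  shows "left_module (corner A u) (evaluation M u)"
proof -
  interpret M: left_module A M by fact
  note mem = evaluation_mem_iff[OF assms]
  note memA = M.R.peirce_iff[OF assms(2,2,3,3)]
  have "abelian_group (evaluation M u)"
  proof (rule abelian_groupI)
    show "\<exists>y \<in> carrier (evaluation M u). y \<oplus>\<^bsub>evaluation M u\<^esub> x = \<zero>\<^bsub>evaluation M u\<^esub>"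
      if "x \<in> carrier (evaluation M u)" for x
    proof (rule bexI[of _ "u \<odot>\<^bsub>M\<^esub> (\<ominus>\<^bsub>M\<^esub> x)"])
      have x: "x \<in> carrier M" "u \<odot>\<^bsub>M\<^esub> x = x" using that by (auto simp: mem)
      have "u \<odot>\<^bsub>M\<^esub> (\<ominus>\<^bsub>M\<^esub> x) \<oplus>\<^bsub>M\<^esub> u \<odot>\<^bsub>M\<^esub> x = u \<odot>\<^bsub>M\<^esub> (\<ominus>\<^bsub>M\<^esub> x \<oplus>\<^bsub>M\<^esub> x)"
        using x(1) assms(2) by (simp add: M.smult_r_distr)
      then show "u \<odot>\<^bsub>M\<^esub> (\<ominus>\<^bsub>M\<^esub> x) \<oplus>\<^bsub>evaluation M u\<^esub> x = \<zero>\<^bsub>evaluation M u\<^esub>"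
        using x assms(2) by (simp add: M.M.l_neg M.smult_zero_right)
      show "u \<odot>\<^bsub>M\<^esub> (\<ominus>\<^bsub>M\<^esub> x) \<in> carrier (evaluation M u)"
        using x(1) by (simp add: evaluation_def)
    qed
  qed (use assms(2) in \<open>auto simp: mem M.M.a_ac M.smult_r_distr
      M.smult_zero_right\<close>)
  moreover have "left_module_axioms (corner A u) (evaluation M u)"
    by (rule left_module_axioms.intro)
       (use assms(2) in \<open>auto simp: mem memA M.smult_closed M.smult_l_distr M.smult_r_distr
          M.smult_assoc1 simp flip: M.smult_assoc1[OF assms(2)]\<close>)
  ultimately show ?thesis
    using ring_corner[OF M.R.ring_axioms assms(2,3)] by (simp add: left_module_def)
qed

lemma evaluation_hom:
  assumes "left_module A P" "left_module A M" "\<pi> \<in> left_module_hom A P M"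
    and "u \<in> carrier A" "u \<otimes>\<^bsub>A\<^esub> u = u"
  shows "\<pi> \<in> left_module_hom (corner A u) (evaluation P u) (evaluation M u)"
proof -
  interpret P: left_module A P by fact
  interpret M: left_module A M by fact
  have \<pi>: "\<And>x. x \<in> carrier P \<Longrightarrow> \<pi> x \<in> carrier M"
    "\<And>x y. x \<in> carrier P \<Longrightarrow> y \<in> carrier P \<Longrightarrow> \<pi> (x \<oplus>\<^bsub>P\<^esub> y) = \<pi> x \<oplus>\<^bsub>M\<^esub> \<pi> y"
    "\<And>a x. a \<in> carrier A \<Longrightarrow> x \<in> carrier P \<Longrightarrow> \<pi> (a \<odot>\<^bsub>P\<^esub> x) = a \<odot>\<^bsub>M\<^esub> \<pi> x"
    using assms(3) by (auto simp: left_module_hom_def)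
  show ?thesis
    unfolding left_module_hom_def
    using \<pi>(1,2) \<pi>(3)[symmetric] assms(4)
    by (simp add: evaluation_mem_iff[OF assms(1,4,5)] evaluation_mem_iff[OF assms(2,4,5)]
        P.R.peirce_iff[OF assms(4,4,5,5)])
qed

lemma evaluation_surj:
  assumes "\<pi> \<in> left_module_hom A P M" "\<pi> ` carrier P = carrier M" "u \<in> carrier A"
  shows "\<pi> ` carrier (evaluation P u) = carrier (evaluation M u)"
proof -
  have "\<pi> ` carrier (evaluation P u) = (\<lambda>p. u \<odot>\<^bsub>M\<^esub> \<pi> p) ` carrier P"
    using assms(1,3) by (auto simp: evaluation_def image_image left_module_hom_def)
  then show ?thesis by (simp add: evaluation_def assms(2)[symmetric] image_image)
qed

text \<open>Evaluation does not preserve projectivity for every idempotent \<open>u\<close>: in general $uP$ is a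
  direct summand of copies of $uA$, which need not be projective over $uAu$. The hypotheses say
  that $a \mapsto uau$ is a ring homomorphism $A \to uAu$ and that $p \mapsto up$ is linear
  over it.\<close>

lemma projective_module_evaluation:
  assumes P: "projective_module A P" and u: "u \<in> carrier A" "u \<otimes>\<^bsub>A\<^esub> u = u"
    and mult: "\<And>a b. a \<in> carrier A \<Longrightarrow> b \<in> carrier A \<Longrightarrow>
      u \<otimes>\<^bsub>A\<^esub> (a \<otimes>\<^bsub>A\<^esub> b) \<otimes>\<^bsub>A\<^esub> u = (u \<otimes>\<^bsub>A\<^esub> a \<otimes>\<^bsub>A\<^esub> u) \<otimes>\<^bsub>A\<^esub> (u \<otimes>\<^bsub>A\<^esub> b \<otimes>\<^bsub>A\<^esub> u)"
    and act: "\<And>a p. a \<in> carrier A \<Longrightarrow> p \<in> carrier P \<Longrightarrow>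
      u \<odot>\<^bsub>P\<^esub> (a \<odot>\<^bsub>P\<^esub> p) = (u \<otimes>\<^bsub>A\<^esub> a \<otimes>\<^bsub>A\<^esub> u) \<odot>\<^bsub>P\<^esub> (u \<odot>\<^bsub>P\<^esub> p)"
  shows "projective_module (corner A u) (evaluation P u)"
  unfolding projective_module_def
proof (intro conjI allI impI)
  have modP: "left_module A P" using P by (simp add: projective_module_def)
  interpret P: left_module A P by fact
  note mem = evaluation_mem_iff[OF modP u] and memA = P.R.peirce_iff[OF u(1) u(1) u(2) u(2)]
  show "left_module (corner A u) (evaluation P u)" by (rule evaluation_left_module[OF modP u])
  fix N :: "('a, 'p \<Rightarrow> 'a) module" and L :: "('a, 'p) module" and g f
  assume "left_module (corner A u) N \<and> left_module (corner A u) L \<and>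
    g \<in> left_module_hom (corner A u) N L \<and> g ` carrier N = carrier L \<and>
    f \<in> left_module_hom (corner A u) (evaluation P u) L"
  then have N: "left_module (corner A u) N" and L: "left_module (corner A u) L"
    and g: "g \<in> left_module_hom (corner A u) N L" "g ` carrier N = carrier L"
    and f: "f \<in> left_module_hom (corner A u) (evaluation P u) L" by auto
  define \<phi> where "\<phi> a = u \<otimes>\<^bsub>A\<^esub> a \<otimes>\<^bsub>A\<^esub> u" for a
  have \<phi>_corner: "\<phi> a \<in> carrier (corner A u)" if "a \<in> carrier A" for a
    using that by (simp add: \<phi>_def peirce_def)
  have \<phi>: "\<phi> \<in> ring_hom A (corner A u)"
    by (rule ring_hom_memI)
       (use u mult \<phi>_corner in \<open>auto simp: \<phi>_def P.R.l_distr P.R.r_distr\<close>)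
  \<comment> \<open>The lifting problem over the corner becomes one over \<open>A\<close> by pulling back along \<open>\<phi>\<close>.\<close>
  have uP: "u \<odot>\<^bsub>P\<^esub> p \<in> carrier (evaluation P u)" if "p \<in> carrier P" for p
    using that by (simp add: evaluation_def)
  let ?N = "restrict_scalars \<phi> N" and ?L = "restrict_scalars \<phi> L"
  have modN: "left_module A ?N" and modL: "left_module A ?L"
    by (rule restrict_scalars_left_module[OF P.R.ring_axioms _ \<phi>], fact)+
  have g': "g \<in> left_module_hom A ?N ?L" "g ` carrier ?N = carrier ?L"
    using g \<phi>_corner by (auto simp: left_module_hom_def restrict_scalars_def)
  have f': "(\<lambda>p. f (u \<odot>\<^bsub>P\<^esub> p)) \<in> left_module_hom A P ?L"
    using f u(1) uP \<phi>_corner act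
    by (auto simp: left_module_hom_def restrict_scalars_def P.smult_r_distr \<phi>_def[symmetric]
        Pi_iff)
  obtain h where h: "h \<in> left_module_hom A P ?N"
    "\<And>p. p \<in> carrier P \<Longrightarrow> g (h p) = f (u \<odot>\<^bsub>P\<^esub> p)"
    using projective_module_lift[OF P modN modL g' f'] by blast
  have "\<phi> a = a" if "a \<in> carrier (corner A u)" for a
    using that by (simp add: memA \<phi>_def)
  then have "h \<in> left_module_hom (corner A u) (evaluation P u) N"
    using h(1) by (auto simp: left_module_hom_def restrict_scalars_def mem memA Pi_iff)
  moreover have "g (h p) = f p" if "p \<in> carrier (evaluation P u)" for p
    using that h(2) by (simp add: mem)
  ultimately show "\<exists>h \<in> left_module_hom (corner A u) (evaluation P u) N.
      \<forall>p \<in> carrier (evaluation P u). g (h p) = f p" by blast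
qed

text \<open>Linearity of $p \mapsto up$ over $a \mapsto uau$ is what makes the preimage of a
  \<open>corner A u\<close>-submodule a submodule over \<open>A\<close>.\<close>

lemma superfluous_evaluation:
  assumes P: "left_module A P" and K: "superfluous A P K"
    and u: "u \<in> carrier A" "u \<otimes>\<^bsub>A\<^esub> u = u"
    and act: "\<And>a p. a \<in> carrier A \<Longrightarrow> p \<in> carrier P \<Longrightarrow>
      u \<odot>\<^bsub>P\<^esub> (a \<odot>\<^bsub>P\<^esub> p) = (u \<otimes>\<^bsub>A\<^esub> a \<otimes>\<^bsub>A\<^esub> u) \<odot>\<^bsub>P\<^esub> (u \<odot>\<^bsub>P\<^esub> p)"
  shows "superfluous (corner A u) (evaluation P u) (K \<inter> carrier (evaluation P u))"
  unfolding superfluous_def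
proof (intro conjI allI impI)
  interpret P: left_module A P by fact
  interpret E: left_module "corner A u" "evaluation P u"
    by (rule evaluation_left_module[OF P u])
  note mem = evaluation_mem_iff[OF P u] and memA = P.R.peirce_iff[OF u(1) u(1) u(2) u(2)]
  have K_sub: "is_submodule K A P" using K by (simp add: superfluous_def)
  note KD = is_submoduleD[OF K_sub]
  show "is_submodule (K \<inter> carrier (evaluation P u)) (corner A u) (evaluation P u)"
  proof (rule E.is_submoduleI)
    show "a \<odot>\<^bsub>evaluation P u\<^esub> x \<in> K \<inter> carrier (evaluation P u)"
      if a: "a \<in> carrier (corner A u)" and x: "x \<in> K \<inter> carrier (evaluation P u)" for a x
    proof
      have "a \<in> carrier A" using a by (simp add: memA)
      then show "a \<odot>\<^bsub>evaluation P u\<^esub> x \<in> K" using KD(4) x by simp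
      show "a \<odot>\<^bsub>evaluation P u\<^esub> x \<in> carrier (evaluation P u)"
        using E.smult_closed[OF a] x by blast
    qed
    show "x \<oplus>\<^bsub>evaluation P u\<^esub> y \<in> K \<inter> carrier (evaluation P u)"
      if "x \<in> K \<inter> carrier (evaluation P u)" "y \<in> K \<inter> carrier (evaluation P u)" for x y
      using that KD(3)[of x y] E.M.a_closed[of x y] by simp
    show "\<zero>\<^bsub>evaluation P u\<^esub> \<in> K \<inter> carrier (evaluation P u)"
      using KD(2) E.M.zero_closed by simp
  qed blast
  fix H
  assume "is_submodule H (corner A u) (evaluation P u) \<and>
    H <+>\<^bsub>evaluation P u\<^esub> (K \<inter> carrier (evaluation P u)) = carrier (evaluation P u)"
  then have H: "is_submodule H (corner A u) (evaluation P u)"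
    and sum: "H <+>\<^bsub>evaluation P u\<^esub> (K \<inter> carrier (evaluation P u)) = carrier (evaluation P u)"
    by auto
  note HD = is_submoduleD[OF H]
  have HP: "x \<in> carrier P" if "x \<in> H" for x using that HD(1) by (auto simp: mem)
  let ?N = "{p \<in> carrier P. u \<odot>\<^bsub>P\<^esub> p \<in> H}"
  have N: "is_submodule ?N A P"
  proof (rule P.is_submoduleI)
    show "a \<odot>\<^bsub>P\<^esub> p \<in> ?N" if a: "a \<in> carrier A" and p: "p \<in> ?N" for a p
    proof -
      have "u \<otimes>\<^bsub>A\<^esub> a \<otimes>\<^bsub>A\<^esub> u \<in> carrier (corner A u)" using a by (simp add: peirce_def)
      then have "(u \<otimes>\<^bsub>A\<^esub> a \<otimes>\<^bsub>A\<^esub> u) \<odot>\<^bsub>P\<^esub> (u \<odot>\<^bsub>P\<^esub> p) \<in> H"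
        using HD(4) p by simp
      then show ?thesis using act[OF a, of p] a p by (simp add: P.smult_closed)
    qed
  qed (use HD(2,3) u(1) in \<open>auto simp: P.smult_zero_right P.smult_r_distr\<close>)
  have "?N <+>\<^bsub>P\<^esub> K = carrier P"
  proof
    show "?N <+>\<^bsub>P\<^esub> K \<subseteq> carrier P" using KD(1) by (auto simp: set_add_def')
    show "carrier P \<subseteq> ?N <+>\<^bsub>P\<^esub> K"
    proof
      fix p assume p: "p \<in> carrier P"
      then have "u \<odot>\<^bsub>P\<^esub> p \<in> H <+>\<^bsub>evaluation P u\<^esub> (K \<inter> carrier (evaluation P u))"
        unfolding sum by (simp add: evaluation_def)
      then obtain h k where hk: "h \<in> H" "k \<in> K" "k \<in> carrier P" "u \<odot>\<^bsub>P\<^esub> k = k"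
          "u \<odot>\<^bsub>P\<^esub> p = h \<oplus>\<^bsub>P\<^esub> k"
        by (auto simp: set_add_def' mem)
      have "u \<odot>\<^bsub>P\<^esub> (p \<ominus>\<^bsub>P\<^esub> k) \<oplus>\<^bsub>P\<^esub> k = u \<odot>\<^bsub>P\<^esub> ((p \<ominus>\<^bsub>P\<^esub> k) \<oplus>\<^bsub>P\<^esub> k)"
        using hk p u(1) by (simp add: P.smult_r_distr)
      also have pk: "(p \<ominus>\<^bsub>P\<^esub> k) \<oplus>\<^bsub>P\<^esub> k = p"
        using hk p by (simp add: a_minus_def P.M.a_assoc P.M.l_neg)
      finally have "u \<odot>\<^bsub>P\<^esub> (p \<ominus>\<^bsub>P\<^esub> k) = h"
        using hk p u(1) HP by (simp add: P.smult_closed)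
      then have "p \<ominus>\<^bsub>P\<^esub> k \<in> ?N" using hk p by simp
      then show "p \<in> ?N <+>\<^bsub>P\<^esub> K" using hk(2) pk[symmetric] unfolding set_add_def' by blast
    qed
  qed
  then have N_eq: "?N = carrier P" using K N by (simp add: superfluous_def)
  show "H = carrier (evaluation P u)"
  proof
    show "H \<subseteq> carrier (evaluation P u)" by (rule HD(1))
    show "carrier (evaluation P u) \<subseteq> H"
    proof
      fix x assume "x \<in> carrier (evaluation P u)"
      then have "x \<in> carrier P" "u \<odot>\<^bsub>P\<^esub> x = x" by (simp_all add: mem)
      then show "x \<in> H" using N_eq by force
    qed
  qed
qed


section \<open>Complete families of orthogonal idempotents\<close>

text \<open>Finitely many pairwise orthogonal idempotents with sum \<open>\<one>\<close>; neither primitive nor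
  nonzero in general. They decompose every left module as the direct sum of its components
  $e_i M$.\<close>

locale complete_orthogonal_idempotents = ring A
  for A :: "('a, 'r) ring_scheme" (structure) +
  fixes I :: "'i set" and e :: "'i \<Rightarrow> 'a"
  assumes finite_index: "finite I"
    and idem_closed: "i \<in> I \<Longrightarrow> e i \<in> carrier A"
    and idem: "i \<in> I \<Longrightarrow> e i \<otimes> e i = e i"
    and orthogonal: "i \<in> I \<Longrightarrow> j \<in> I \<Longrightarrow> i \<noteq> j \<Longrightarrow> e i \<otimes> e j = \<zero>"
    and complete: "(\<Oplus>i \<in> I. e i) = \<one>"
begin

lemma sum_components:
  assumes "left_module A M" "m \<in> carrier M"
  shows "(\<Oplus>\<^bsub>M\<^esub>i \<in> I. e i \<odot>\<^bsub>M\<^esub> m) = m"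
proof -
  interpret M: left_module A M by fact
  show ?thesis
    using M.finsum_smult[OF finite_index _ assms(2), of e] idem_closed assms(2)
    by (simp add: complete M.smult_one Pi_iff)
qed

lemma smult_eq_smult_component:
  assumes "left_module A M" "c \<in> carrier A" "m \<in> carrier M" "x \<in> I"
    and "\<And>y. y \<in> I \<Longrightarrow> y \<noteq> x \<Longrightarrow> c \<odot>\<^bsub>M\<^esub> (e y \<odot>\<^bsub>M\<^esub> m) = \<zero>\<^bsub>M\<^esub>"
  shows "c \<odot>\<^bsub>M\<^esub> m = c \<odot>\<^bsub>M\<^esub> (e x \<odot>\<^bsub>M\<^esub> m)"
proof -
  interpret M: left_module A M by fact
  have closed: "c \<odot>\<^bsub>M\<^esub> (e i \<odot>\<^bsub>M\<^esub> m) \<in> carrier M" if "i \<in> I" for i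
    using that assms idem_closed by (simp add: M.smult_closed)
  have "c \<odot>\<^bsub>M\<^esub> m = c \<odot>\<^bsub>M\<^esub> (\<Oplus>\<^bsub>M\<^esub>i \<in> I. e i \<odot>\<^bsub>M\<^esub> m)"
    by (simp add: sum_components assms(1,3))
  also have "\<dots> = (\<Oplus>\<^bsub>M\<^esub>i \<in> I. c \<odot>\<^bsub>M\<^esub> (e i \<odot>\<^bsub>M\<^esub> m))"
    by (rule M.smult_finsum[OF assms(2) finite_index])
       (use assms idem_closed in \<open>auto intro!: M.smult_closed\<close>)
  also have "\<dots> = (\<Oplus>\<^bsub>M\<^esub>i \<in> {x}. c \<odot>\<^bsub>M\<^esub> (e i \<odot>\<^bsub>M\<^esub> m))"
    by (rule M.add.finprod_mono_neutral_cong_right) (use finite_index assms closed in auto)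
  also have "\<dots> = c \<odot>\<^bsub>M\<^esub> (e x \<odot>\<^bsub>M\<^esub> m)" using closed[OF assms(4)] by simp
  finally show ?thesis .
qed

text \<open>If $M$ vanishes outside an index set $Q$ that is closed under successors, in the sense that
  $e_z A e_y = 0$ for $y \in Q$ and $z \notin Q$, then so does its projective cover.\<close>

lemma projective_cover_supported:
  assumes cover: "projective_cover A P \<pi> M"
    and Q: "Q \<subseteq> I"
    and closed: "\<And>y z a. y \<in> Q \<Longrightarrow> z \<in> I - Q \<Longrightarrow> a \<in> carrier A \<Longrightarrow> e z \<otimes> a \<otimes> e y = \<zero>"
    and supp: "\<And>z m. z \<in> I - Q \<Longrightarrow> m \<in> carrier M \<Longrightarrow> e z \<odot>\<^bsub>M\<^esub> m = \<zero>\<^bsub>M\<^esub>"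
    and z: "z \<in> I - Q" and p: "p \<in> carrier P"
  shows "e z \<odot>\<^bsub>P\<^esub> p = \<zero>\<^bsub>P\<^esub>"
proof -
  have P: "left_module A P" and M: "left_module A M" and \<pi>: "\<pi> \<in> left_module_hom A P M"
    and K: "superfluous A P (a_kernel P M \<pi>)"
    using cover by (auto simp: projective_cover_def projective_module_def)
  interpret P: left_module A P by fact
  interpret M: left_module A M by fact
  let ?K = "a_kernel P M \<pi>"
  have eP: "e i \<odot>\<^bsub>P\<^esub> p \<in> carrier P" if "i \<in> I" "p \<in> carrier P" for i p
    using that idem_closed by (simp add: P.smult_closed)
  have \<pi>_simps: "\<pi> p \<in> carrier M" "a \<in> carrier A \<Longrightarrow> \<pi> (a \<odot>\<^bsub>P\<^esub> p) = a \<odot>\<^bsub>M\<^esub> \<pi> p"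
    "q \<in> carrier P \<Longrightarrow> \<pi> (p \<oplus>\<^bsub>P\<^esub> q) = \<pi> p \<oplus>\<^bsub>M\<^esub> \<pi> q" if "p \<in> carrier P" for p q a
    using \<pi> that by (auto simp: left_module_hom_def)
  let ?N = "{p \<in> carrier P. \<forall>z \<in> I - Q. e z \<odot>\<^bsub>P\<^esub> p = \<zero>\<^bsub>P\<^esub>}"
  have N: "is_submodule ?N A P"
  proof (rule P.is_submoduleI)
    fix a p assume a: "a \<in> carrier A" and p: "p \<in> ?N"
    have "e z \<odot>\<^bsub>P\<^esub> (a \<odot>\<^bsub>P\<^esub> p) = \<zero>\<^bsub>P\<^esub>" if z: "z \<in> I - Q" for z
    proof -
      have ez: "e z \<in> carrier A" using z idem_closed by blast
      have vanish: "(e z \<otimes> a) \<odot>\<^bsub>P\<^esub> (e y \<odot>\<^bsub>P\<^esub> p) = \<zero>\<^bsub>P\<^esub>" if y: "y \<in> I" for y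
      proof (cases "y \<in> Q")
        case True
        then have "(e z \<otimes> a \<otimes> e y) \<odot>\<^bsub>P\<^esub> p = \<zero>\<^bsub>P\<^esub>"
          using closed[OF _ z a] p by (simp add: P.smult_zero_left)
        then show ?thesis using a ez p idem_closed[OF y] by (simp add: P.smult_assoc1)
      next
        case False
        then show ?thesis using a ez p y by (simp add: P.smult_zero_right)
      qed
      have "(e z \<otimes> a) \<odot>\<^bsub>P\<^esub> p = (e z \<otimes> a) \<odot>\<^bsub>P\<^esub> (e z \<odot>\<^bsub>P\<^esub> p)"
        by (rule smult_eq_smult_component[OF P]) (use a ez p z vanish in auto)
      then show ?thesis using a ez p z vanish[of z] by (simp add: P.smult_assoc1)
    qed
    then show "a \<odot>\<^bsub>P\<^esub> p \<in> ?N" using a p by (simp add: P.smult_closed)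
  qed (use idem_closed in \<open>auto simp: P.smult_zero_right P.smult_r_distr\<close>)
  have "?N <+>\<^bsub>P\<^esub> ?K = carrier P"
  proof
    show "?N <+>\<^bsub>P\<^esub> ?K \<subseteq> carrier P" by (auto simp: set_add_def' a_kernel_def')
    show "carrier P \<subseteq> ?N <+>\<^bsub>P\<^esub> ?K"
    proof
      fix p assume p: "p \<in> carrier P"
      \<comment> \<open>\<open>q\<close> is the part of \<open>p\<close> in the components over \<open>Q\<close>. It has the same image as \<open>p\<close>,
        because the remaining components of \<open>M\<close> are zero.\<close>
      define q where "q = (\<Oplus>\<^bsub>P\<^esub>y \<in> Q. e y \<odot>\<^bsub>P\<^esub> p)"
      have finQ: "finite Q" using Q finite_index by (rule finite_subset)
      have comp: "(\<lambda>y. e y \<odot>\<^bsub>P\<^esub> p) \<in> Q \<rightarrow> carrier P" using eP p Q by blast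
      have q: "q \<in> carrier P" unfolding q_def by (rule P.M.finsum_closed[OF comp])
      have "e z \<odot>\<^bsub>P\<^esub> q = \<zero>\<^bsub>P\<^esub>" if z: "z \<in> I - Q" for z
      proof -
        have "e z \<odot>\<^bsub>P\<^esub> q = (\<Oplus>\<^bsub>P\<^esub>y \<in> Q. e z \<odot>\<^bsub>P\<^esub> (e y \<odot>\<^bsub>P\<^esub> p))"
          unfolding q_def by (rule P.smult_finsum[OF _ finQ comp]) (use z idem_closed in blast)
        also have "\<dots> = (\<Oplus>\<^bsub>P\<^esub>y \<in> Q. \<zero>\<^bsub>P\<^esub>)"
        proof (rule P.M.finsum_cong'[OF refl])
          fix y assume y: "y \<in> Q"
          have "e z \<otimes> e y = \<zero>" using orthogonal[of z y] y z Q by blast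
          moreover have "e z \<in> carrier A" "e y \<in> carrier A" using y z Q idem_closed by blast+
          ultimately show "e z \<odot>\<^bsub>P\<^esub> (e y \<odot>\<^bsub>P\<^esub> p) = \<zero>\<^bsub>P\<^esub>"
            using p by (metis P.smult_assoc1 P.smult_zero_left)
        qed simp
        finally show ?thesis by simp
      qed
      then have qN: "q \<in> ?N" using q by simp
      have "\<pi> q = (\<Oplus>\<^bsub>M\<^esub>y \<in> Q. \<pi> (e y \<odot>\<^bsub>P\<^esub> p))"
        unfolding q_def by (rule left_module_hom_finsum[OF P M \<pi> finQ comp])
      also have "\<dots> = (\<Oplus>\<^bsub>M\<^esub>y \<in> I. e y \<odot>\<^bsub>M\<^esub> \<pi> p)"
        by (rule M.M.add.finprod_mono_neutral_cong_left)
           (use finite_index Q supp \<pi>_simps p idem_closed in \<open>auto intro!: M.smult_closed\<close>)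
      also have "\<dots> = \<pi> p" by (rule sum_components[OF M \<pi>_simps(1)[OF p]])
      finally have \<pi>q: "\<pi> q = \<pi> p" .
      have pq: "q \<oplus>\<^bsub>P\<^esub> (\<ominus>\<^bsub>P\<^esub> q \<oplus>\<^bsub>P\<^esub> p) = p"
        using p q P.M.a_assoc[of q "\<ominus>\<^bsub>P\<^esub> q" p] by (simp add: P.M.r_neg)
      have "\<pi> q \<oplus>\<^bsub>M\<^esub> \<pi> (\<ominus>\<^bsub>P\<^esub> q \<oplus>\<^bsub>P\<^esub> p) = \<pi> q"
        using \<pi>_simps(3)[OF q, of "\<ominus>\<^bsub>P\<^esub> q \<oplus>\<^bsub>P\<^esub> p"] p q by (simp add: pq \<pi>q)
      then have "\<pi> (\<ominus>\<^bsub>P\<^esub> q \<oplus>\<^bsub>P\<^esub> p) = \<zero>\<^bsub>M\<^esub>" using p q \<pi>_simps(1) by simp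
      then have "\<ominus>\<^bsub>P\<^esub> q \<oplus>\<^bsub>P\<^esub> p \<in> ?K" using p q by (simp add: a_kernel_def')
      then show "p \<in> ?N <+>\<^bsub>P\<^esub> ?K" using qN pq[symmetric] unfolding set_add_def' by blast
    qed
  qed
  then have "?N = carrier P" using K N by (simp add: superfluous_def)
  then show ?thesis using p z by blast
qed

lemma corner_projection_mult:
  assumes x: "x \<in> I"
    and directed: "\<And>y a b. y \<in> I \<Longrightarrow> y \<noteq> x \<Longrightarrow> a \<in> carrier A \<Longrightarrow> b \<in> carrier A \<Longrightarrow>
      e x \<otimes> a \<otimes> e y = \<zero> \<or> e y \<otimes> b \<otimes> e x = \<zero>"
    and a: "a \<in> carrier A" and b: "b \<in> carrier A"
  shows "e x \<otimes> (a \<otimes> b) \<otimes> e x = (e x \<otimes> a \<otimes> e x) \<otimes> (e x \<otimes> b \<otimes> e x)"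
proof -
  have ex: "e x \<in> carrier A" "e x \<otimes> e x = e x" using x idem_closed idem by auto
  let ?R = "regular_module A"
  \<comment> \<open>In $e_x a b e_x = \sum_y e_x a e_y b e_x$ only the summand for $y = x$ survives.\<close>
  have "(e x \<otimes> a) \<odot>\<^bsub>?R\<^esub> (b \<otimes> e x) = (e x \<otimes> a) \<odot>\<^bsub>?R\<^esub> (e x \<odot>\<^bsub>?R\<^esub> (b \<otimes> e x))"
  proof (rule smult_eq_smult_component[OF regular_module_left_module])
    fix y assume y: "y \<in> I" "y \<noteq> x"
    have "(e x \<otimes> a) \<otimes> (e y \<otimes> (b \<otimes> e x)) = \<zero>"
    proof (cases "e x \<otimes> a \<otimes> e y = \<zero>")
      case True
      then have "(e x \<otimes> a \<otimes> e y) \<otimes> (b \<otimes> e x) = \<zero>" using b ex by simp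
      then show ?thesis using a b ex idem_closed[OF y(1)] by (simp add: m_assoc)
    next
      case False
      then have "e y \<otimes> b \<otimes> e x = \<zero>" using directed[OF y a b] by simp
      then show ?thesis using a b ex idem_closed[OF y(1)] by (simp add: m_assoc)
    qed
    then show "(e x \<otimes> a) \<odot>\<^bsub>?R\<^esub> (e y \<odot>\<^bsub>?R\<^esub> (b \<otimes> e x)) = \<zero>\<^bsub>?R\<^esub>"
      by (simp add: regular_module_def)
  qed (use a b ex x in \<open>auto simp: regular_module_def\<close>)
  then have "(e x \<otimes> a) \<otimes> (b \<otimes> e x) = (e x \<otimes> a) \<otimes> (e x \<otimes> (b \<otimes> e x))"
    by (simp add: regular_module_def)
  also have "\<dots> = (e x \<otimes> a) \<otimes> ((e x \<otimes> e x) \<otimes> (b \<otimes> e x))" by (simp only: ex(2))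
  finally show ?thesis using a b ex(1) by (simp only: m_assoc m_closed)
qed

lemma corner_projection_smult:
  assumes P: "left_module A P" and x: "x \<in> I"
    and vanish: "\<And>y a p. y \<in> I \<Longrightarrow> y \<noteq> x \<Longrightarrow> a \<in> carrier A \<Longrightarrow> p \<in> carrier P \<Longrightarrow>
      e x \<otimes> a \<otimes> e y = \<zero> \<or> e y \<odot>\<^bsub>P\<^esub> p = \<zero>\<^bsub>P\<^esub>"
    and a: "a \<in> carrier A" and p: "p \<in> carrier P"
  shows "e x \<odot>\<^bsub>P\<^esub> (a \<odot>\<^bsub>P\<^esub> p) = (e x \<otimes> a \<otimes> e x) \<odot>\<^bsub>P\<^esub> (e x \<odot>\<^bsub>P\<^esub> p)"
proof -
  interpret P: left_module A P by fact
  have ex: "e x \<in> carrier A" "e x \<otimes> e x = e x" using x idem_closed idem by auto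
  have "(e x \<otimes> a) \<odot>\<^bsub>P\<^esub> p = (e x \<otimes> a) \<odot>\<^bsub>P\<^esub> (e x \<odot>\<^bsub>P\<^esub> p)"
  proof (rule smult_eq_smult_component[OF P])
    fix y assume y: "y \<in> I" "y \<noteq> x"
    have "(e x \<otimes> a) \<odot>\<^bsub>P\<^esub> (e y \<odot>\<^bsub>P\<^esub> p) = (e x \<otimes> a \<otimes> e y) \<odot>\<^bsub>P\<^esub> p"
      using a ex p idem_closed[OF y(1)] by (simp add: P.smult_assoc1)
    then show "(e x \<otimes> a) \<odot>\<^bsub>P\<^esub> (e y \<odot>\<^bsub>P\<^esub> p) = \<zero>\<^bsub>P\<^esub>"
      using vanish[OF y a p] a ex p by (auto simp: P.smult_zero_left P.smult_zero_right)
  qed (use a ex p x in auto)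
  also have "\<dots> = (e x \<otimes> a) \<odot>\<^bsub>P\<^esub> ((e x \<otimes> e x) \<odot>\<^bsub>P\<^esub> p)" by (simp only: ex(2))
  finally show ?thesis using a p ex(1) by (simp only: P.smult_assoc1 m_closed P.smult_closed)
qed

end

text \<open>The hypothesis \<open>directed\<close> excludes nonzero maps in both directions between \<open>x\<close> and another
  index \<open>y\<close>, and \<open>vanish\<close> says that $P$ is zero at every proper predecessor of \<open>x\<close>.\<close>

lemma projective_cover_evaluation:
  assumes cover: "projective_cover A P \<pi> M" and idems: "complete_orthogonal_idempotents A I e"
    and x: "x \<in> I"
    and directed: "\<And>y a b. y \<in> I \<Longrightarrow> y \<noteq> x \<Longrightarrow> a \<in> carrier A \<Longrightarrow> b \<in> carrier A \<Longrightarrow>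
      e x \<otimes>\<^bsub>A\<^esub> a \<otimes>\<^bsub>A\<^esub> e y = \<zero>\<^bsub>A\<^esub> \<or> e y \<otimes>\<^bsub>A\<^esub> b \<otimes>\<^bsub>A\<^esub> e x = \<zero>\<^bsub>A\<^esub>"
    and vanish: "\<And>y a p. y \<in> I \<Longrightarrow> y \<noteq> x \<Longrightarrow> a \<in> carrier A \<Longrightarrow> p \<in> carrier P \<Longrightarrow>
      e x \<otimes>\<^bsub>A\<^esub> a \<otimes>\<^bsub>A\<^esub> e y = \<zero>\<^bsub>A\<^esub> \<or> e y \<odot>\<^bsub>P\<^esub> p = \<zero>\<^bsub>P\<^esub>"
  shows "projective_cover (corner A (e x)) (evaluation P (e x)) \<pi> (evaluation M (e x))"
proof -
  interpret complete_orthogonal_idempotents A I e by fact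
  have P: "left_module A P" and M: "left_module A M" and \<pi>: "\<pi> \<in> left_module_hom A P M"
    and surj: "\<pi> ` carrier P = carrier M" and proj: "projective_module A P"
    and K: "superfluous A P (a_kernel P M \<pi>)"
    using cover by (auto simp: projective_cover_def projective_module_def)
  interpret P: left_module A P by fact
  note ex = idem_closed[OF x] idem[OF x]
  note act = corner_projection_smult[OF P x vanish]
  have "a_kernel (evaluation P (e x)) (evaluation M (e x)) \<pi> =
      a_kernel P M \<pi> \<inter> carrier (evaluation P (e x))"
    by (auto simp: a_kernel_def' evaluation_mem_iff[OF P ex])
  then show ?thesis
    unfolding projective_cover_def
    using projective_module_evaluation[OF proj ex corner_projection_mult[OF x directed] act]
      evaluation_left_module[OF M ex] evaluation_hom[OF P M \<pi> ex] evaluation_surj[OF \<pi> surj ex(1)]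
      superfluous_evaluation[OF P K ex act]
    by simp
qed


section \<open>The associated category\<close>

lemma directed_stratification_idempotents:
  assumes "ring A" "directed_stratification A n e"
  shows "complete_orthogonal_idempotents A {1..n} e"
  using assms
  by (auto simp: complete_orthogonal_idempotents_def complete_orthogonal_idempotents_axioms_def
      directed_stratification_def Pi_iff)

lemma (in k_algebra) peirce_vectorspace:
  assumes "u \<in> carrier A" "v \<in> carrier A" "u \<otimes>\<^bsub>A\<^esub> u = u" "v \<otimes>\<^bsub>A\<^esub> v = v"
  shows "vectorspace K (A\<lparr>carrier := peirce A u v\<rparr>)"
proof -
  note mem = A.peirce_iff[OF assms]
  have "subspace K (peirce A u v) A"
    unfolding subspace_def
  proof (intro conjI vectorspace_axioms submodule.intro module.module_axioms)
    show "c \<odot>\<^bsub>A\<^esub> x \<in> peirce A u v" if "c \<in> carrier K" "x \<in> peirce A u v" for c x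
      using that assms(1,2) by (simp add: mem smult_mult_left smult_mult_right)
  qed (use assms(1,2) in \<open>auto simp: mem A.l_distr A.r_distr\<close>)
  from subspace_is_vs[OF this] show ?thesis .
qed

text \<open>The basis of $e_j A e_i$ that corresponds to the morphisms $x_i \to x_j$ is empty exactly if
  the space is zero.\<close>

lemma associated_category_Mor_empty_iff:
  assumes K: "k_algebra K A" and strat: "directed_stratification A n e"
    and cat: "associated_category K A n e \<C>" and ij: "i \<in> {1..n}" "j \<in> {1..n}"
  shows "Mor \<C> i j = {} \<longleftrightarrow> peirce A (e j) (e i) = {\<zero>\<^bsub>A\<^esub>}"
proof -
  interpret k_algebra K A by fact
  interpret complete_orthogonal_idempotents A "{1..n}" e
    by (rule directed_stratification_idempotents[OF A.ring_axioms strat])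
  let ?V = "A\<lparr>carrier := peirce A (e j) (e i)\<rparr>"
  interpret V: vectorspace K ?V
    by (intro peirce_vectorspace idem_closed idem ij)
  obtain B \<beta> where B: "V.basis B" and \<beta>: "bij_betw \<beta> (Mor \<C> i j) B"
    using cat ij unfolding associated_category_def by blast
  have "Mor \<C> i j = {} \<longleftrightarrow> B = {}" using \<beta> by (auto simp: bij_betw_def)
  also have "\<dots> \<longleftrightarrow> peirce A (e j) (e i) = {\<zero>\<^bsub>A\<^esub>}"
  proof
    assume "B = {}"
    then show "peirce A (e j) (e i) = {\<zero>\<^bsub>A\<^esub>}"
      using B V.span_empty by (simp add: V.basis_def)
  next
    assume "peirce A (e j) (e i) = {\<zero>\<^bsub>A\<^esub>}"
    then have "B \<subseteq> {\<zero>\<^bsub>A\<^esub>}" using B unfolding V.basis_def by simp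
    moreover have "\<zero>\<^bsub>A\<^esub> \<notin> B"
      using B V.vs_zero_lin_dep[of B] unfolding V.basis_def by simp
    ultimately show "B = {}" by auto
  qed
  finally show ?thesis .
qed

theorem theorem3p1:
  fixes K :: "'k ring" and A :: "('k, 'a) module" and n :: nat and e :: "nat \<Rightarrow> 'a"
    and \<C> :: "(nat, 'f) category"
    and M :: "('a, 'm) module" and P :: "('a, 'p) module" and \<pi> :: "'p \<Rightarrow> 'm"
  assumes "fin_dim_algebra K A"
    and "directed_stratification A n e"
    and "associated_category K A n e \<C>"
    and "left_module A M" and "finitely_generated A M"
    and "projective_cover A P \<pi> M"
  shows "supported_on \<C> e P (subcategory_of_module \<C> e M) \<and>
    (\<forall>x. minimal_object \<C> e M x \<longrightarrow>
       projective_cover (corner A (e x)) (evaluation P (e x)) \<pi> (evaluation M (e x)))"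
proof -
  have kA: "k_algebra K A" using assms(1) by (simp add: fin_dim_algebra_def)
  interpret k_algebra K A by fact
  have idems: "complete_orthogonal_idempotents A {1..n} e"
    by (rule directed_stratification_idempotents[OF A.ring_axioms assms(2)])
  interpret idems: complete_orthogonal_idempotents A "{1..n}" e by fact
  interpret \<C>: finite_category \<C> using assms(3) by (simp add: associated_category_def)
  interpret M: left_module A M by fact
  have modP: "left_module A P"
    using assms(6) by (simp add: projective_cover_def projective_module_def)
  interpret P: left_module A P by fact
  have Ob: "Ob \<C> = {1..n}" using assms(3) by (simp add: associated_category_def)
  have zero_iff: "zero_module (evaluation M (e y)) \<longleftrightarrow> (\<forall>m \<in> carrier M. e y \<odot>\<^bsub>M\<^esub> m = \<zero>\<^bsub>M\<^esub>)"
    "zero_module (evaluation P (e y)) \<longleftrightarrow> (\<forall>p \<in> carrier P. e y \<odot>\<^bsub>P\<^esub> p = \<zero>\<^bsub>P\<^esub>)"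
    if "y \<in> {1..n}" for y
    using that by (simp_all add: zero_module_evaluation_iff[OF assms(4)]
        zero_module_evaluation_iff[OF modP] idems.idem_closed)
  have Mor_empty: "Mor \<C> i j = {} \<longleftrightarrow> peirce A (e j) (e i) = {\<zero>\<^bsub>A\<^esub>}"
    if "i \<in> {1..n}" "j \<in> {1..n}" for i j
    using associated_category_Mor_empty_iff[OF kA assms(2,3) that] .
  have no_arrow: "e j \<otimes>\<^bsub>A\<^esub> a \<otimes>\<^bsub>A\<^esub> e i = \<zero>\<^bsub>A\<^esub>"
    if "Mor \<C> i j = {}" "i \<in> {1..n}" "j \<in> {1..n}" "a \<in> carrier A" for i j a
    using that Mor_empty[OF that(2,3)]
    by (simp add: A.peirce_eq_zero_iff idems.idem_closed)
  have le: "i \<le> j" if "Mor \<C> i j \<noteq> {}" "i \<in> {1..n}" "j \<in> {1..n}" for i j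
    using that assms(2) unfolding Mor_empty[OF that(2,3)] directed_stratification_def
    by (meson not_le)
  have trans: "Mor \<C> i l \<noteq> {}"
    if "Mor \<C> i j \<noteq> {}" "Mor \<C> j l \<noteq> {}" "i \<in> {1..n}" "j \<in> {1..n}" "l \<in> {1..n}" for i j l
    using that \<C>.Comp_in_Mor[of i j l] unfolding Ob by blast
  have refl: "Mor \<C> i i \<noteq> {}" if "i \<in> {1..n}" for i
    using that \<C>.Ident_in_Mor[of i] unfolding Ob by blast
  let ?min = "minimal_object \<C> e M"
  have min_Ob: "x \<in> {1..n}" if "?min x" for x using that Ob by (simp add: minimal_object_def)
  define Q where "Q = Ob (subcategory_of_module \<C> e M)"
  have Q_iff: "y \<in> Q \<longleftrightarrow> y \<in> {1..n} \<and> (\<exists>x. ?min x \<and> Mor \<C> x y \<noteq> {})" for y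
    by (simp add: Q_def subcategory_of_module_def Ob)
  have M_supp: "zero_module (evaluation M (e z))" if z: "z \<in> {1..n} - Q" for z
  proof (rule ccontr)
    let ?S = "{i \<in> {1..n}. \<not> zero_module (evaluation M (e i)) \<and> Mor \<C> i z \<noteq> {}}"
    assume "\<not> zero_module (evaluation M (e z))"
    then have "z \<in> ?S" using z refl by blast
    define x where "x = Min ?S"
    \<comment> \<open>A predecessor of \<open>x\<close> at which \<open>M\<close> does not vanish would be a smaller element of \<open>?S\<close>.\<close>
    have fin: "finite ?S" by simp
    have x: "x \<in> ?S" unfolding x_def using fin \<open>z \<in> ?S\<close> by (intro Min_in) blast+
    have "?min x"
      unfolding minimal_object_def Ob
    proof (intro conjI ballI impI)
      fix y assume y: "y \<in> {1..n}" "y \<noteq> x \<and> Mor \<C> y x \<noteq> {}"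
      show "zero_module (evaluation M (e y))"
      proof (rule ccontr)
        assume "\<not> zero_module (evaluation M (e y))"
        then have "y \<in> ?S" using y x trans[of y x z] z by blast
        then have "x \<le> y" unfolding x_def by (rule Min_le[OF fin])
        then show False using le[of y x] x y by simp
      qed
    qed (use x in auto)
    then show False using x z by (auto simp: Q_iff)
  qed
  have P_supp: "e z \<odot>\<^bsub>P\<^esub> p = \<zero>\<^bsub>P\<^esub>" if "z \<in> {1..n} - Q" "p \<in> carrier P" for z p
  proof (rule idems.projective_cover_supported[OF assms(6) _ _ _ that])
    show "Q \<subseteq> {1..n}" by (auto simp: Q_iff)
    show "e z \<otimes>\<^bsub>A\<^esub> a \<otimes>\<^bsub>A\<^esub> e y = \<zero>\<^bsub>A\<^esub>"
      if y: "y \<in> Q" and z: "z \<in> {1..n} - Q" and a: "a \<in> carrier A" for y z a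
    proof (rule no_arrow)
      show "Mor \<C> y z = {}"
        using y z trans min_Ob unfolding Q_iff Diff_iff by blast
    qed (use y z a in \<open>auto simp: Q_iff\<close>)
    show "e z \<odot>\<^bsub>M\<^esub> m = \<zero>\<^bsub>M\<^esub>" if "z \<in> {1..n} - Q" "m \<in> carrier M" for z m
      using M_supp[OF that(1)] zero_iff(1) that by blast
  qed
  have "supported_on \<C> e P (subcategory_of_module \<C> e M)"
    unfolding supported_on_def Ob Q_def[symmetric] using zero_iff(2) P_supp by blast
  moreover have "projective_cover (corner A (e x)) (evaluation P (e x)) \<pi> (evaluation M (e x))"
    if x: "?min x" for x
  proof (rule projective_cover_evaluation[OF assms(6) idems])
    show x_Ob: "x \<in> {1..n}" by (rule min_Ob[OF x])
    fix y a assume y: "y \<in> {1..n}" "y \<noteq> x" and a: "a \<in> carrier A"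
    show "e x \<otimes>\<^bsub>A\<^esub> a \<otimes>\<^bsub>A\<^esub> e y = \<zero>\<^bsub>A\<^esub> \<or> e y \<otimes>\<^bsub>A\<^esub> b \<otimes>\<^bsub>A\<^esub> e x = \<zero>\<^bsub>A\<^esub>"
      if "b \<in> carrier A" for b
    proof -
      have "Mor \<C> y x = {} \<or> Mor \<C> x y = {}" using le[of x y] le[of y x] x_Ob y by force
      then show ?thesis using no_arrow x_Ob y a that by blast
    qed
    show "e x \<otimes>\<^bsub>A\<^esub> a \<otimes>\<^bsub>A\<^esub> e y = \<zero>\<^bsub>A\<^esub> \<or> e y \<odot>\<^bsub>P\<^esub> p = \<zero>\<^bsub>P\<^esub>" if p: "p \<in> carrier P" for p
    proof (cases "Mor \<C> y x = {}")
      case True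
      then show ?thesis using no_arrow x_Ob y a by blast
    next
      case False
      have "y \<notin> Q"
      proof
        assume "y \<in> Q"
        then obtain w where w: "?min w" "Mor \<C> w y \<noteq> {}" by (auto simp: Q_iff)
        then have "Mor \<C> w x \<noteq> {}" using trans[of w y x] False y x_Ob min_Ob by blast
        moreover have "\<not> zero_module (evaluation M (e w))"
          using w(1) by (simp add: minimal_object_def)
        ultimately have "w = x"
          using x min_Ob[OF w(1)] unfolding minimal_object_def Ob by blast
        then have "x \<le> y" "y \<le> x" using le w(2) False y x_Ob by blast+
        then show False using y by simp
      qed
      then show ?thesis using P_supp p y by blast
    qed
  qed
  ultimately show ?thesis by blast
qed

end
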